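(* In Pandora's Matching Problem, the Best-of-Two-Worlds algorithm achieves at least a $1/4$-approximation of the optimal welfare: for every instance, its expected welfare is at least $\tfrac14 \mathrm{Welfare}(\textsc{Opt})$.
   Context: Pandora's Matching Problem. An instance consists of a finite undirected graph $G=(V,E)$, not necessarily bipartite, and, for each edge $\{i,j\}\in E$, two Pandora boxes: box $(i,j)$ with a known distribution $D_{ij}$ over $\mathbb{R}$ (with finite mean) and a known cost $c_{ij}\ge 0$, and box $(j,i)$ with $D_{ji}$ and $c_{ji}\ge 0$. The values $v_{ij}\sim D_{ij}$ are drawn independently over all boxes. An algorithm repeatedly chooses an unopened box $(i,j)$, pays $c_{ij}$ and observes $v_{ij}$; its choices may depend on everything observed so far (and on internal randomness). Eventually it stops and outputs a matching of $G$ consisting only of edges both of whose boxes have been opened. Let $\mathbb{I}_{ij}$ indicate that box $(i,j)$ was opened and $\mathbb{A}_{ij}=\mathbb{A}_{ji}$ indicate that $\{i,j\}$ is in the output matching. The welfare of an algorithm is $\mathrm{Welfare}=\mathbb{E}\big[\sum_{(i,j)}(\mathbb{A}_{ij}v_{ij}-\mathbb{I}_{ij}c_{ij})\big]$, the sum over all boxes. $\textsc{Opt}$ denotes a welfare-maximizing algorithm. Orientations and nested indices. An orientation $\mathcal{O}$ of $G$ is a set of ordered pairs containing, for each edge $\{i,j\}$, exactly one of $(i,j)$, $(j,i)$; its reverse is $\hat{\mathcal{O}}=\{(j,i):(i,j)\in\mathcal{O}\}$. For $(i,j)\in\mathcal{O}$ the edge is treated as a two-stage basket: stage 1 opens box $(i,j)$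 (cost $c_{ij}$, reveals $v_{ij}$), stage 2 opens box $(j,i)$ (cost $c_{ji}$, reveals the total $v_{ij}+v_{ji}$), and advancing the basket once both boxes are open means adding $\{i,j\}$ to the matching. Its indices are defined by backward induction: $\sigma^{(3)}_{ij}=\kappa^{(3)}_{ij}=v_{ij}+v_{ji}$; $\sigma^{(2)}_{ij}$ is the function of $v_{ij}$ that solves $\mathbb{E}[(\kappa^{(3)}_{ij}-\sigma^{(2)}_{ij})^+\mid v_{ij}]=c_{ji}$, and $\kappa^{(2)}_{ij}=\min(\sigma^{(2)}_{ij},\kappa^{(3)}_{ij})$; $\sigma^{(1)}_{ij}$ is the real number solving $\mathbb{E}[(\kappa^{(2)}_{ij}-\sigma^{(1)}_{ij})^+]=c_{ij}$. Here $(x)^+=\max(x,0)$. The current Weitzman index of the basket is $\sigma^{(1)}_{ij}$ if no box of the edge is open, $\sigma^{(2)}_{ij}$ if only $(i,j)$ is open, and $\sigma^{(3)}_{ij}$ if both are open. $\mathcal{O}$-Oriented Descending Procedure: maintain a set $S$ (initially $\mathcal{O}$) and a matching $M$ (initially empty). Repeatedly: if $S$ is empty or the largest current index among baskets in $S$ is negative, stop and output $M$; otherwise advance the basket $(i,j)\in S$ with the largest current index (open its next box, or, if both boxes are open, add $\{i,j\}$ to $M$ and delete from $S$ all oriented edges incident to $i$ or $j$). Best-of-Two-Worlds algorithm: pick an arbitrary orientation $\mathcal{O}$, compute the expected welfare of the $\mathcal{O}$-Oriented Descending Procedure and of the $\hat{\mathcal{O}}$-Oriented Descending Procedure, and run the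 one with the larger expected welfare. *)

theory Defs
  imports "HOL-Probability.Probability" "HOL-Library.While_Combinator" "HOL-Library.Disjoint_Sets"
begin

record 'v pandora =
  verts :: "'v set"
  edges :: "'v set set"
  dist_of :: "'v \<times> 'v \<Rightarrow> real measure"
  cost :: "'v \<times> 'v \<Rightarrow> real"

definition boxes :: "'v pandora \<Rightarrow> ('v \<times> 'v) set" where
  "boxes P = {(i, j). {i, j} \<in> edges P}"

definition pandora_instance :: "'v pandora \<Rightarrow> bool" where
  "pandora_instance P \<longleftrightarrow>
     finite (verts P) \<and>
     (\<forall>e \<in> edges P. e \<subseteq> verts P \<and> card e = 2) \<and>
     (\<forall>b \<in> boxes P. prob_space (dist_of P b) \<and> sets (dist_of P b) = sets borel \<and>
        integrable (dist_of P b) (\<lambda>x. x) \<and> 0 \<le> cost P b)"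

definition value_measure :: "'v pandora \<Rightarrow> ('v \<times> 'v \<Rightarrow> real) measure" where
  "value_measure P = PiM (boxes P) (dist_of P)"

definition is_matching :: "'v pandora \<Rightarrow> 'v set set \<Rightarrow> bool" where
  "is_matching P M \<longleftrightarrow> M \<subseteq> edges P \<and> disjoint M"

text \<open>An outcome is the list of opened boxes together with the output matching.\<close>

definition payoff ::
    "'v pandora \<Rightarrow> ('v \<times> 'v \<Rightarrow> real) \<Rightarrow> ('v \<times> 'v) list \<times> 'v set set \<Rightarrow> real" where
  "payoff P v = (\<lambda>(bs, M). \<Sum>(i, j) \<in> boxes P.
     of_bool ({i, j} \<in> M) * v (i, j) - of_bool ((i, j) \<in> set bs) * cost P (i, j))"

text \<open>A history lists the opened boxes with the values found in them, in order of opening.\<close>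

type_synonym 'v history = "(('v \<times> 'v) \<times> real) list"

definition observe :: "('v \<times> 'v \<Rightarrow> real) \<Rightarrow> ('v \<times> 'v) list \<Rightarrow> 'v history" where
  "observe v bs = map (\<lambda>b. (b, v b)) bs"

datatype 'v action = is_Open: Open (next_box: "'v \<times> 'v") | Stop (out_matching: "'v set set")

fun legal_action :: "'v pandora \<Rightarrow> ('v \<times> 'v) list \<Rightarrow> 'v action \<Rightarrow> bool" where
  "legal_action P bs (Open b) \<longleftrightarrow> b \<in> boxes P \<and> b \<notin> set bs"
| "legal_action P bs (Stop M) \<longleftrightarrow>
     is_matching P M \<and> (\<forall>i j. {i, j} \<in> M \<longrightarrow> (i, j) \<in> set bs \<and> (j, i) \<in> set bs)"

text \<open>
  Internal randomness is a seed with law \<open>R\<close>, drawn independently of the values; an algorithm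
  maps the seed and the history to its next action.
\<close>

definition is_algorithm ::
    "'v pandora \<Rightarrow> 's measure \<Rightarrow> ('s \<Rightarrow> 'v history \<Rightarrow> 'v action) \<Rightarrow> bool" where
  "is_algorithm P R \<pi> \<longleftrightarrow>
     (\<forall>bs. distinct bs \<and> set bs \<subseteq> boxes P \<longrightarrow>
        (\<forall>s \<in> space R. \<forall>v \<in> space (value_measure P). legal_action P bs (\<pi> s (observe v bs))) \<and>
        (\<lambda>(s, v). \<pi> s (observe v bs))
          \<in> measurable (R \<Otimes>\<^sub>M value_measure P) (count_space UNIV))"

definition run_algorithm ::
    "('v history \<Rightarrow> 'v action) \<Rightarrow> ('v \<times> 'v \<Rightarrow> real) \<Rightarrow> ('v \<times> 'v) list \<times> 'v set set" where
  "run_algorithm \<pi> v =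
     (let bs = while (\<lambda>bs. is_Open (\<pi> (observe v bs)))
                     (\<lambda>bs. bs @ [next_box (\<pi> (observe v bs))]) []
      in (bs, out_matching (\<pi> (observe v bs))))"

definition welfare ::
    "'v pandora \<Rightarrow> 's measure \<Rightarrow> ('s \<Rightarrow> 'v history \<Rightarrow> 'v action) \<Rightarrow> real" where
  "welfare P R \<pi> = (\<integral>(s, v). payoff P v (run_algorithm (\<pi> s) v) \<partial>(R \<Otimes>\<^sub>M value_measure P))"

definition opt_welfare :: "'v pandora \<Rightarrow> 's measure \<Rightarrow> ereal" where
  "opt_welfare P R = (SUP \<pi> \<in> {\<pi>. is_algorithm P R \<pi>}. ereal (welfare P R \<pi>))"

definition is_orientation :: "'v pandora \<Rightarrow> ('v \<times> 'v) set \<Rightarrow> bool" where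
  "is_orientation P Ori \<longleftrightarrow>
     Ori \<subseteq> boxes P \<and> (\<forall>(i, j) \<in> boxes P. (i, j) \<in> Ori \<longleftrightarrow> (j, i) \<notin> Ori)"

definition kappa3 :: "real \<Rightarrow> real \<Rightarrow> ereal" where
  "kappa3 x y = ereal (x + y)"

definition kappa2 :: "(real \<Rightarrow> ereal) \<Rightarrow> real \<Rightarrow> real \<Rightarrow> ereal" where
  "kappa2 s2 x y = min (s2 x) (kappa3 x y)"

text \<open>
  \<open>\<sigma>1 (i, j)\<close> and \<open>\<sigma>2 (i, j) x\<close> (where \<open>x\<close> is the value of box \<open>(i, j)\<close>) are the indices of the
  basket whose first stage is \<open>(i, j)\<close>. As the values are independent, conditioning on
  \<open>v (i, j) = x\<close> leaves an expectation over the law of box \<open>(j, i)\<close>.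

  For a positive cost the solution of an index equation is a unique real number. For cost 0
  the solutions are the upper bounds of the essential supremum, and when that is infinite the
  only solution is \<open>\<infinity>\<close>; hence the indices are extended reals, and any solution is admitted.
  No solution is \<open>-\<infinity>\<close>, since then the left-hand side is infinite.
\<close>

definition are_indices ::
    "'v pandora \<Rightarrow> ('v \<times> 'v \<Rightarrow> ereal) \<Rightarrow> ('v \<times> 'v \<Rightarrow> real \<Rightarrow> ereal) \<Rightarrow> bool" where
  "are_indices P \<sigma>1 \<sigma>2 \<longleftrightarrow>
     (\<forall>(i, j) \<in> boxes P.
        \<sigma>2 (i, j) \<in> borel_measurable borel \<and>
        (\<forall>x. (\<integral>\<^sup>+ y. e2ennreal (max 0 (kappa3 x y - \<sigma>2 (i, j) x)) \<partial>dist_of P (j, i))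
               = ennreal (cost P (j, i))) \<and>
        (\<integral>\<^sup>+ v. e2ennreal (max 0 (kappa2 (\<sigma>2 (i, j)) (v (i, j)) (v (j, i)) - \<sigma>1 (i, j)))
            \<partial>value_measure P) = ennreal (cost P (i, j)))"

definition current_index ::
    "('v \<times> 'v \<Rightarrow> ereal) \<Rightarrow> ('v \<times> 'v \<Rightarrow> real \<Rightarrow> ereal) \<Rightarrow> 'v history \<Rightarrow> 'v \<times> 'v \<Rightarrow> ereal" where
  "current_index \<sigma>1 \<sigma>2 h = (\<lambda>(i, j).
     case map_of h (i, j) of
       None \<Rightarrow> \<sigma>1 (i, j)
     | Some x \<Rightarrow> (case map_of h (j, i) of
           None \<Rightarrow> \<sigma>2 (i, j) x
         | Some y \<Rightarrow> kappa3 x y))"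

text \<open>
  A selection rule picks a basket of largest current index in \<open>S\<close>; ties may be broken
  arbitrarily, but only on the basis of what has been observed. Since nonempty subsets of an
  orientation and of its reverse are never equal, one rule can break ties independently in
  the two procedures.
\<close>

definition is_selection ::
    "'v pandora \<Rightarrow> ('v \<times> 'v \<Rightarrow> ereal) \<Rightarrow> ('v \<times> 'v \<Rightarrow> real \<Rightarrow> ereal) \<Rightarrow>
     ('v history \<Rightarrow> ('v \<times> 'v) set \<Rightarrow> 'v \<times> 'v) \<Rightarrow> bool" where
  "is_selection P \<sigma>1 \<sigma>2 sel \<longleftrightarrow>
     (\<forall>S. S \<noteq> {} \<and> S \<subseteq> boxes P \<longrightarrow>
        (\<forall>h. sel h S \<in> S \<and>
             (\<forall>b \<in> S. current_index \<sigma>1 \<sigma>2 h b \<le> current_index \<sigma>1 \<sigma>2 h (sel h S))) \<and>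
        (\<forall>bs. distinct bs \<and> set bs \<subseteq> boxes P \<longrightarrow>
             (\<lambda>v. sel (observe v bs) S) \<in> measurable (value_measure P) (count_space UNIV)))"

text \<open>A state consists of the opened boxes, the set \<open>S\<close> and the matching \<open>M\<close>.\<close>

type_synonym 'v state = "('v \<times> 'v) list \<times> ('v \<times> 'v) set \<times> 'v set set"

definition descending_continues ::
    "('v \<times> 'v \<Rightarrow> ereal) \<Rightarrow> ('v \<times> 'v \<Rightarrow> real \<Rightarrow> ereal) \<Rightarrow> ('v \<times> 'v \<Rightarrow> real) \<Rightarrow>
     'v state \<Rightarrow> bool" where
  "descending_continues \<sigma>1 \<sigma>2 v = (\<lambda>(bs, S, M).
     S \<noteq> {} \<and> \<not> Max (current_index \<sigma>1 \<sigma>2 (observe v bs) ` S) < 0)"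

definition descending_step ::
    "('v history \<Rightarrow> ('v \<times> 'v) set \<Rightarrow> 'v \<times> 'v) \<Rightarrow> ('v \<times> 'v \<Rightarrow> real) \<Rightarrow> 'v state \<Rightarrow> 'v state" where
  "descending_step sel v = (\<lambda>(bs, S, M).
     let (i, j) = sel (observe v bs) S in
       if (i, j) \<notin> set bs then (bs @ [(i, j)], S, M)
       else if (j, i) \<notin> set bs then (bs @ [(j, i)], S, M)
       else (bs, {(k, l) \<in> S. {k, l} \<inter> {i, j} = {}}, insert {i, j} M))"

definition run_descending ::
    "('v \<times> 'v \<Rightarrow> ereal) \<Rightarrow> ('v \<times> 'v \<Rightarrow> real \<Rightarrow> ereal) \<Rightarrow>
     ('v history \<Rightarrow> ('v \<times> 'v) set \<Rightarrow> 'v \<times> 'v) \<Rightarrow> ('v \<times> 'v) set \<Rightarrow>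
     ('v \<times> 'v \<Rightarrow> real) \<Rightarrow> ('v \<times> 'v) list \<times> 'v set set" where
  "run_descending \<sigma>1 \<sigma>2 sel Ori v =
     (let (bs, S, M) = while (descending_continues \<sigma>1 \<sigma>2 v) (descending_step sel v) ([], Ori, {})
      in (bs, M))"

definition descending_welfare ::
    "'v pandora \<Rightarrow> ('v \<times> 'v \<Rightarrow> ereal) \<Rightarrow> ('v \<times> 'v \<Rightarrow> real \<Rightarrow> ereal) \<Rightarrow>
     ('v history \<Rightarrow> ('v \<times> 'v) set \<Rightarrow> 'v \<times> 'v) \<Rightarrow> ('v \<times> 'v) set \<Rightarrow> real" where
  "descending_welfare P \<sigma>1 \<sigma>2 sel Ori =
     (\<integral>v. payoff P v (run_descending \<sigma>1 \<sigma>2 sel Ori v) \<partial>value_measure P)"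

definition run_best_of_two_worlds ::
    "'v pandora \<Rightarrow> ('v \<times> 'v \<Rightarrow> ereal) \<Rightarrow> ('v \<times> 'v \<Rightarrow> real \<Rightarrow> ereal) \<Rightarrow>
     ('v history \<Rightarrow> ('v \<times> 'v) set \<Rightarrow> 'v \<times> 'v) \<Rightarrow> ('v \<times> 'v) set \<Rightarrow>
     ('v \<times> 'v \<Rightarrow> real) \<Rightarrow> ('v \<times> 'v) list \<times> 'v set set" where
  "run_best_of_two_worlds P \<sigma>1 \<sigma>2 sel Ori =
     (if descending_welfare P \<sigma>1 \<sigma>2 sel (Ori\<inverse>) \<le> descending_welfare P \<sigma>1 \<sigma>2 sel Ori
      then run_descending \<sigma>1 \<sigma>2 sel Ori
      else run_descending \<sigma>1 \<sigma>2 sel (Ori\<inverse>))"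

definition best_of_two_worlds_welfare ::
    "'v pandora \<Rightarrow> ('v \<times> 'v \<Rightarrow> ereal) \<Rightarrow> ('v \<times> 'v \<Rightarrow> real \<Rightarrow> ereal) \<Rightarrow>
     ('v history \<Rightarrow> ('v \<times> 'v) set \<Rightarrow> 'v \<times> 'v) \<Rightarrow> ('v \<times> 'v) set \<Rightarrow> real" where
  "best_of_two_worlds_welfare P \<sigma>1 \<sigma>2 sel Ori =
     (\<integral>v. payoff P v (run_best_of_two_worlds P \<sigma>1 \<sigma>2 sel Ori v) \<partial>value_measure P)"

end

theory Submission imports Defs begin

text \<open>
  Write \<open>k1\<close> for the minimum of all three indices of a basket, \<open>k2\<close> for the minimum of the last two,
  and \<open>k3\<close> for the last. The index equations say that the cost of the first box is the mean of
  \<open>k2 - k1\<close>, and the cost of the second box the conditional mean of \<open>k3 - k2\<close>. The decision to open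
  a box is independent of what is still hidden, so in expectation every cost may be
  replaced by the corresponding difference. Hence, if each edge is oriented by the order in which an
  algorithm opens its boxes, the welfare of that algorithm is at most the expected \<open>k1\<close>-weight of
  its matching. This matching splits into a part oriented along \<open>Ori\<close> and a part oriented along the
  reverse.

  For the descending procedure the bound is an equality: a basket whose index
  rises after a box is opened stays on top until it is matched, so no difference is paid for an
  unmatched edge. Moreover the procedure builds a greedy matching for the weights \<open>k1\<close>, which has at
  least half the weight of any other matching. The two procedures together thus earn at least half
  of the optimum, and the better one a quarter.
\<close>

section \<open>Loops\<close>

text \<open>Past the exit the guarded body is the identity, so iterating it for too long is
  harmless. This replaces \<open>while\<close> by powers of a total map, to which induction on time
  and measurability arguments apply.\<close>

lemma while_eq_funpow:
  assumes "\<not> b (((\<lambda>s. if b s then c s else s) ^^ n) s)"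
  shows "while b c s = ((\<lambda>s. if b s then c s else s) ^^ n) s"
  using assms
proof (induction n arbitrary: s)
  case 0
  then show ?case by (simp add: while_unfold)
next
  case (Suc n)
  let ?f = "\<lambda>s. if b s then c s else s"
  have "while b c s = while b c (?f s)"
    by (subst while_unfold) (simp add: while_unfold)
  also have "\<dots> = (?f ^^ n) (?f s)"
    using Suc.prems by (intro Suc.IH) (simp only: funpow_Suc_right o_apply not_False_eq_True)
  finally show ?case by (simp only: funpow_Suc_right o_apply)
qed

lemma eventually_exits:
  fixes m :: "'s \<Rightarrow> nat"
  assumes "\<And>s. I s \<Longrightarrow> b s \<Longrightarrow> I (c s) \<and> m (c s) < m s" and "I s"
  shows "\<exists>n. \<not> b (((\<lambda>s. if b s then c s else s) ^^ n) s)"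
  using \<open>I s\<close>
proof (induction "m s" arbitrary: s rule: less_induct)
  case less
  show ?case
  proof (cases "b s")
    case True
    with less assms(1) obtain n where "\<not> b (((\<lambda>s. if b s then c s else s) ^^ n) (c s))"
      by blast
    then have "\<not> b (((\<lambda>s. if b s then c s else s) ^^ Suc n) s)"
      using True by (simp only: funpow_Suc_right o_apply if_True not_False_eq_True)
    then show ?thesis by blast
  next
    case False
    then have "\<not> b (((\<lambda>s. if b s then c s else s) ^^ 0) s)" by simp
    then show ?thesis by blast
  qed
qed

section \<open>Independence in finite products of real laws\<close>

text \<open>A fresh draw of one coordinate preserves the product law. After coordinate
  \<open>i\<close> is split off on both sides, the left integrand no longer depends on the old
  value, which integrates to a factor 1.\<close>

lemma (in product_sigma_finite) nn_integral_resample: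
  assumes "finite I" "i \<in> I" "prob_space (M i)"
    and f [measurable]: "f \<in> borel_measurable (Pi\<^sub>M I M)"
  shows "(\<integral>\<^sup>+ x. (\<integral>\<^sup>+ y. f (x(i := y)) \<partial>M i) \<partial>Pi\<^sub>M I M) = (\<integral>\<^sup>+ x. f x \<partial>Pi\<^sub>M I M)"
proof -
  interpret i: prob_space "M i" by fact
  let ?J = "I - {i}"
  have upd: "(\<lambda>(x, y). x(i := y)) \<in> Pi\<^sub>M I M \<Otimes>\<^sub>M M i \<rightarrow>\<^sub>M Pi\<^sub>M I M"
    using measurable_add_dim[of i I M] \<open>i \<in> I\<close> by (simp add: insert_absorb)
  have [measurable]: "(\<lambda>x. \<integral>\<^sup>+ y. f (x(i := y)) \<partial>M i) \<in> borel_measurable (Pi\<^sub>M I M)"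
    using measurable_compose[OF upd f]
    by (intro M.borel_measurable_nn_integral) (simp add: case_prod_beta' split_def)
  have ins: "(\<integral>\<^sup>+ x. g x \<partial>Pi\<^sub>M I M) = (\<integral>\<^sup>+ x. (\<integral>\<^sup>+ y. g (x(i := y)) \<partial>M i) \<partial>Pi\<^sub>M ?J M)"
    if "g \<in> borel_measurable (Pi\<^sub>M I M)" for g
    using product_nn_integral_insert[of ?J i g] \<open>finite I\<close> \<open>i \<in> I\<close> that
    by (simp add: insert_absorb)
  show ?thesis
    by (subst (1 2) ins) (simp_all add: i.emeasure_space_1)
qed

locale finite_real_product = product_prob_space M I
  for M :: "'b \<Rightarrow> real measure" and I :: "'b set" +
  assumes finite_I: "finite I" and sets_M: "\<And>i. sets (M i) = sets borel"
begin

abbreviation "W \<equiv> Pi\<^sub>M I M"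

lemma space_M: "space (M i) = UNIV"
  using sets_eq_imp_space_eq[OF sets_M] by simp

lemma upd_in_space: "v \<in> space W \<Longrightarrow> i \<in> I \<Longrightarrow> v(i := y) \<in> space W"
  by (auto simp: space_PiM space_M PiE_iff extensional_def)

lemma resample:
  assumes "i \<in> I" "f \<in> borel_measurable W"
  shows "(\<integral>\<^sup>+ x. (\<integral>\<^sup>+ y. f (x(i := y)) \<partial>M i) \<partial>W) = (\<integral>\<^sup>+ x. f x \<partial>W)"
  using assms finite_I M.prob_space_axioms by (intro nn_integral_resample) auto

text \<open>Resampling coordinate \<open>i\<close> leaves \<open>E\<close> unchanged and averages
  \<open>h\<close> to \<open>c\<close>, so the event factors out.\<close>

lemma nn_integral_indep_one:
  assumes i: "i \<in> I" and [measurable]: "h \<in> borel_measurable W" "Measurable.pred W E"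
    and inv: "\<And>v y. v \<in> space W \<Longrightarrow> E (v(i := y)) = E v"
    and h: "\<And>v. v \<in> space W \<Longrightarrow> (\<integral>\<^sup>+ y. h (v(i := y)) \<partial>M i) = c"
  shows "(\<integral>\<^sup>+ v. of_bool (E v) * h v \<partial>W) = c * emeasure W {v \<in> space W. E v}"
proof -
  have "(\<integral>\<^sup>+ v. of_bool (E v) * h v \<partial>W)
      = (\<integral>\<^sup>+ v. (\<integral>\<^sup>+ y. of_bool (E (v(i := y))) * h (v(i := y)) \<partial>M i) \<partial>W)"
    using i by (subst resample) simp_all
  also have "\<dots> = (\<integral>\<^sup>+ v. c * indicator {v \<in> space W. E v} v \<partial>W)"
    by (intro nn_integral_cong) (auto simp: inv h)
  also have "\<dots> = c * emeasure W {v \<in> space W. E v}"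
    by (subst nn_integral_cmult_indicator) auto
  finally show ?thesis .
qed

text \<open>Only the joint mean over both coordinates is known here, so \<open>j\<close> is
  resampled first; what remains is a function of \<open>v i\<close>, to which the one-coordinate
  case applies.\<close>

lemma nn_integral_indep_two:
  assumes i: "i \<in> I" and j: "j \<in> I" and ne: "i \<noteq> j"
    and g [measurable]: "(\<lambda>(x, y). g x y) \<in> borel_measurable (borel \<Otimes>\<^sub>M borel)"
    and [measurable]: "Measurable.pred W E"
    and inv: "\<And>v y. v \<in> space W \<Longrightarrow> E (v(i := y)) = E v" "\<And>v y. v \<in> space W \<Longrightarrow> E (v(j := y)) = E v"
    and h: "(\<integral>\<^sup>+ v. g (v i) (v j) \<partial>W) = c"
  shows "(\<integral>\<^sup>+ v. of_bool (E v) * g (v i) (v j) \<partial>W) = c * emeasure W {v \<in> space W. E v}"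
proof -
  have [measurable]: "(\<lambda>v. v i) \<in> borel_measurable W" "(\<lambda>v. v j) \<in> borel_measurable W"
    using measurable_component_singleton[of i I M] measurable_component_singleton[of j I M] i j
    by (simp_all cong: measurable_cong_sets add: sets_M)
  define d where "d = (\<integral>\<^sup>+ x. (\<integral>\<^sup>+ y. g x y \<partial>M j) \<partial>M i)"
  have main: "(\<integral>\<^sup>+ v. of_bool (E v) * g (v i) (v j) \<partial>W) = d * emeasure W {v \<in> space W. E v}"
    if [measurable]: "Measurable.pred W E"
      and inv: "\<And>v y. v \<in> space W \<Longrightarrow> E (v(i := y)) = E v" "\<And>v y. v \<in> space W \<Longrightarrow> E (v(j := y)) = E v"
    for E
  proof -
    have gy [measurable]: "(\<lambda>x. \<integral>\<^sup>+ y. g x y \<partial>M j) \<in> borel_measurable borel"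
    proof -
      have "(\<lambda>(x, y). g x y) \<in> borel_measurable (borel \<Otimes>\<^sub>M M j)"
        using g by (simp cong: measurable_cong_sets add: sets_M)
      then show ?thesis
        by (intro M.borel_measurable_nn_integral)
    qed
    have "(\<integral>\<^sup>+ v. of_bool (E v) * g (v i) (v j) \<partial>W)
        = (\<integral>\<^sup>+ v. (\<integral>\<^sup>+ y. of_bool (E (v(j := y))) * g ((v(j := y)) i) ((v(j := y)) j) \<partial>M j) \<partial>W)"
      using j by (subst resample) simp_all
    also have "\<dots> = (\<integral>\<^sup>+ v. of_bool (E v) * (\<integral>\<^sup>+ y. g (v i) y \<partial>M j) \<partial>W)"
      using ne by (intro nn_integral_cong) (auto simp: inv)
    also have "\<dots> = d * emeasure W {v \<in> space W. E v}"
    proof (rule nn_integral_indep_one[OF i])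
      show "(\<lambda>v. \<integral>\<^sup>+ y. g (v i) y \<partial>M j) \<in> borel_measurable W"
        using measurable_compose[OF _ gy] by measurable
    qed (auto simp: inv d_def)
    finally show ?thesis .
  qed
  \<comment> \<open>The sure event identifies the iterated mean \<open>d\<close> with the given
    constant.\<close>
  have "d = c"
    using main[of "\<lambda>_. True"] h by (simp add: emeasure_space_1)
  then show ?thesis
    using main[of E] inv by simp
qed

text \<open>The right-hand side of \<open>eq\<close> is finite, which makes \<open>k\<close>
  integrable on \<open>E\<close> and turns the equation into one between Bochner integrals.\<close>

lemma mean_zero:
  fixes k :: "('b \<Rightarrow> real) \<Rightarrow> real"
  assumes [measurable]: "k \<in> borel_measurable W" "Measurable.pred W E"
    and k: "\<And>v. v \<in> space W \<Longrightarrow> 0 \<le> k v" and c: "0 \<le> c"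
    and eq: "(\<integral>\<^sup>+ v. of_bool (E v) * ennreal (k v) \<partial>W) = ennreal c * emeasure W {v \<in> space W. E v}"
  shows "integrable W (\<lambda>v. of_bool (E v) * (c - k v))"
    and "(\<integral>v. of_bool (E v) * (c - k v) \<partial>W) = 0"
proof -
  have eq': "(\<integral>\<^sup>+ v. ennreal (of_bool (E v) * k v) \<partial>W) = ennreal (c * measure W {v \<in> space W. E v})"
  proof -
    have "(\<integral>\<^sup>+ v. ennreal (of_bool (E v) * k v) \<partial>W) = (\<integral>\<^sup>+ v. of_bool (E v) * ennreal (k v) \<partial>W)"
      by (intro nn_integral_cong) auto
    then show ?thesis
      using eq c by (simp add: emeasure_eq_measure ennreal_mult)
  qed
  have nn: "AE v in W. 0 \<le> of_bool (E v) * k v"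
    using k by (intro AE_I2) auto
  have 1: "has_bochner_integral W (\<lambda>v. of_bool (E v) * k v) (c * measure W {v \<in> space W. E v})"
    using nn c eq' by (intro has_bochner_integral_nn_integral) auto
  have "has_bochner_integral W (\<lambda>v. c * indicator {v \<in> space W. E v} v) (c * measure W {v \<in> space W. E v})"
    by (intro has_bochner_integral_mult_right has_bochner_integral_real_indicator)
      (auto simp: less_top[symmetric])
  then have 2: "has_bochner_integral W (\<lambda>v. of_bool (E v) * c) (c * measure W {v \<in> space W. E v})"
    by (rule has_bochner_integral_cong[THEN iffD1, rotated 3]) auto
  have "has_bochner_integral W (\<lambda>v. of_bool (E v) * c - of_bool (E v) * k v) (c * measure W {v \<in> space W. E v} - c * measure W {v \<in> space W. E v})"
    by (rule has_bochner_integral_diff[OF 2 1])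
  then have "has_bochner_integral W (\<lambda>v. of_bool (E v) * (c - k v)) 0"
    by (simp add: right_diff_distrib)
  then show "integrable W (\<lambda>v. of_bool (E v) * (c - k v))"
    and "(\<integral>v. of_bool (E v) * (c - k v) \<partial>W) = 0"
    by (auto simp: has_bochner_integral_iff)
qed

end

section \<open>Adaptive exploration\<close>

text \<open>
  Arbitrary algorithms and the descending procedures are both instances: the state evolves
  deterministically, and a step may depend on \<open>v\<close> only through the coordinates opened so far.
\<close>

locale exploration =
  fixes V :: "('b \<Rightarrow> real) measure" and X :: "'x set" and x0 :: 'x
    and F :: "('b \<Rightarrow> real) \<Rightarrow> 'x \<Rightarrow> 'x" and opn :: "'x \<Rightarrow> 'b set"
  assumes countable_X: "countable X" and init: "x0 \<in> X" and opn_init: "opn x0 = {}"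
    and closed: "\<And>v x. v \<in> space V \<Longrightarrow> x \<in> X \<Longrightarrow> F v x \<in> X"
    and local: "\<And>v v' x. v \<in> space V \<Longrightarrow> v' \<in> space V \<Longrightarrow> x \<in> X \<Longrightarrow>
      (\<And>b. b \<in> opn x \<Longrightarrow> v b = v' b) \<Longrightarrow> F v x = F v' x"
    and grow: "\<And>v x. v \<in> space V \<Longrightarrow> x \<in> X \<Longrightarrow> opn x \<subseteq> opn (F v x)"
    and single: "\<And>v x a a'. v \<in> space V \<Longrightarrow> x \<in> X \<Longrightarrow>
      a \<in> opn (F v x) - opn x \<Longrightarrow> a' \<in> opn (F v x) - opn x \<Longrightarrow> a = a'"
    and F_meas: "\<And>x. x \<in> X \<Longrightarrow> (\<lambda>v. F v x) \<in> V \<rightarrow>\<^sub>M count_space X"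
begin

definition state :: "nat \<Rightarrow> ('b \<Rightarrow> real) \<Rightarrow> 'x" where
  "state n v = (F v ^^ n) x0"

lemma state_0 [simp]: "state 0 v = x0" and state_Suc: "state (Suc n) v = F v (state n v)"
  by (simp_all add: state_def)

lemma state_in: "v \<in> space V \<Longrightarrow> state n v \<in> X"
  by (induction n) (simp_all add: init closed state_Suc)

lemma state_meas [measurable]: "state n \<in> V \<rightarrow>\<^sub>M count_space X"
proof (induction n)
  case 0
  then show ?case using init by (simp add: state_def[abs_def])
next
  case (Suc n)
  show ?case
    using measurable_compose_countable'[OF F_meas Suc countable_X]
    by (simp add: state_Suc[abs_def])
qed

lemma opn_mono: "v \<in> space V \<Longrightarrow> m \<le> n \<Longrightarrow> opn (state m v) \<subseteq> opn (state n v)"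
  by (rule lift_Suc_mono_le[of "\<lambda>n. opn (state n v)"]) (simp_all add: state_Suc grow state_in)

text \<open>Until a coordinate in \<open>B\<close> is open, both runs observe the same values. The
  successor state is included because the step that first opens a box of \<open>B\<close> is still
  chosen without seeing its value.\<close>

lemma state_cong:
  assumes v: "v \<in> space V" "v' \<in> space V" and eq: "\<And>b. b \<notin> B \<Longrightarrow> v b = v' b"
    and "opn (state n v) \<inter> B = {}"
  shows "state n v = state n v' \<and> state (Suc n) v = state (Suc n) v'"
  using assms(4)
proof (induction n)
  case 0
  then show ?case using local[OF v init] eq by (auto simp: state_Suc)
next
  case (Suc n)
  have "opn (state n v) \<inter> B = {}"
    using opn_mono[OF v(1), of n "Suc n"] Suc.prems by auto
  with Suc.IH have *: "state (Suc n) v = state (Suc n) v'" by blast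
  have "F v (state (Suc n) v) = F v' (state (Suc n) v)"
    using Suc.prems eq by (intro local[OF v state_in[OF v(1)]]) auto
  then show ?case using * by (simp add: state_Suc)
qed

text \<open>
  The restriction to times when nothing in \<open>B\<close> is open makes the event independent of the
  coordinates in \<open>B\<close>.
\<close>

definition opens :: "'b set \<Rightarrow> ('x \<Rightarrow> 'x \<Rightarrow> bool) \<Rightarrow> ('b \<Rightarrow> real) \<Rightarrow> bool" where
  "opens B Q v \<longleftrightarrow> (\<exists>n. opn (state n v) \<inter> B = {} \<and> Q (state n v) (state (Suc n) v))"

lemma opens_cong:
  assumes v: "v \<in> space V" "v' \<in> space V" and eq: "\<And>b. b \<notin> B \<Longrightarrow> v b = v' b"
  shows "opens B Q v = opens B Q v'"
  unfolding opens_def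
  using state_cong[OF v eq] state_cong[OF v(2,1), of B] eq by metis

lemma pred_state: "Measurable.pred V (\<lambda>v. Q (state n v))"
  by (rule measurable_compose[OF state_meas]) simp

lemma opens_meas [measurable]: "Measurable.pred V (opens B Q)"
proof -
  have "Measurable.pred V (\<lambda>v. opn (state n v) \<inter> B = {} \<and> Q (state n v) (state (Suc n) v))" for n
  proof -
    \<comment> \<open>There are countably many states, so measurability may be checked with the
      current state held fixed.\<close>
    have "Measurable.pred V (\<lambda>v. Q (state n v) (F v (state n v)))"
      by (rule measurable_compose_countable'[OF _ state_meas countable_X, where f = "\<lambda>x v. Q x (F v x)"])
        (rule measurable_compose[OF F_meas], simp_all)
    then show ?thesis
      unfolding state_Suc by (intro pred_intros_logic pred_state)
  qed
  then show ?thesis unfolding opens_def[abs_def] by measurable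
qed

definition opened :: "'b \<Rightarrow> ('b \<Rightarrow> real) \<Rightarrow> bool" where
  "opened b v \<longleftrightarrow> (\<exists>n. b \<in> opn (state n v))"

lemma opening_time:
  assumes "opened b v"
  obtains n where "b \<notin> opn (state n v)" "b \<in> opn (state (Suc n) v)"
proof -
  from assms obtain n where "b \<in> opn (state n v)" by (auto simp: opened_def)
  moreover have "b \<notin> opn (state 0 v)" by (simp add: opn_init)
  ultimately show ?thesis
    using that by (induction n) auto
qed

lemma opening_time_unique:
  assumes v: "v \<in> space V" and "b \<notin> opn (state n v)" "b \<in> opn (state (Suc n) v)"
    "b \<notin> opn (state m v)" "b \<in> opn (state (Suc m) v)"
  shows "n = m"
proof (rule ccontr)
  assume "n \<noteq> m"
  then have "Suc n \<le> m \<or> Suc m \<le> n" by auto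
  then show False using assms opn_mono[OF v] by blast
qed

end

section \<open>Capped indices and amortised costs\<close>

text \<open>Passing to a real loses nothing when \<open>t \<noteq> -\<infinity>\<close>: the minimum
  with a real is then finite, even for an infinite index.\<close>

definition cap :: "ereal \<Rightarrow> real \<Rightarrow> real" where
  "cap t a = real_of_ereal (min t (ereal a))"

lemma ereal_cap: "t \<noteq> -\<infinity> \<Longrightarrow> ereal (cap t a) = min t (ereal a)"
  unfolding cap_def by (cases t) (auto simp: min_def)

lemma cap_le: "t \<noteq> -\<infinity> \<Longrightarrow> cap t a \<le> a"
  using ereal_cap[of t a] by (metis ereal_less_eq(3) min.cobounded2)

text \<open>The identity (a - t)^+ = a - min(t, a), which turns each index equation into one about a
  difference of capped indices.\<close>

lemma excess_eq_cap: "t \<noteq> -\<infinity> \<Longrightarrow> e2ennreal (max 0 (ereal a - t)) = ennreal (a - cap t a)"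
  unfolding cap_def by (cases t) (auto simp: min_def max_def ereal_minus(1) simp flip: e2ennreal_ereal zero_ereal_def)

lemma cap_meas [measurable]:
  assumes [measurable]: "f \<in> borel_measurable M" "g \<in> borel_measurable M"
  shows "(\<lambda>x. cap (f x) (g x)) \<in> borel_measurable M"
  unfolding cap_def by measurable

locale pandora_indices =
  fixes P :: "'v pandora" and \<sigma>1 :: "'v \<times> 'v \<Rightarrow> ereal" and \<sigma>2 :: "'v \<times> 'v \<Rightarrow> real \<Rightarrow> ereal"
  assumes instance_P: "pandora_instance P" and indices: "are_indices P \<sigma>1 \<sigma>2"
begin

abbreviation "Box \<equiv> boxes P"

text \<open>
  The product measure lemmas need a probability measure at every index, while the instance
  constrains \<open>dist_of\<close> on the boxes only.
\<close>

definition law :: "'v \<times> 'v \<Rightarrow> real measure" where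
  "law b = (if b \<in> Box then dist_of P b else return borel 0)"

section \<open>The instance as a finite product of real laws\<close>

lemma finite_boxes: "finite Box"
proof (rule finite_subset)
  show "Box \<subseteq> verts P \<times> verts P"
    using instance_P by (fastforce simp: boxes_def pandora_instance_def)
  show "finite (verts P \<times> verts P)"
    using instance_P by (simp add: pandora_instance_def)
qed

lemma finite_edges: "finite (edges P)"
proof (rule finite_subset)
  show "edges P \<subseteq> Pow (verts P)"
    using instance_P by (fastforce simp: pandora_instance_def)
  show "finite (Pow (verts P))"
    using instance_P by (simp add: pandora_instance_def)
qed

lemma swap_in_boxes [simp]: "prod.swap b \<in> Box \<longleftrightarrow> b \<in> Box"
  by (cases b) (simp add: boxes_def insert_commute)

lemma swap_neq: "b \<in> Box \<Longrightarrow> prod.swap b \<noteq> b"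
proof -
  assume "b \<in> Box"
  then have "card {fst b, snd b} = 2"
    using instance_P by (auto simp: boxes_def pandora_instance_def)
  then show ?thesis by (cases b) auto
qed

lemma cost_nonneg: "b \<in> Box \<Longrightarrow> 0 \<le> cost P b"
  using instance_P by (simp add: pandora_instance_def)

sublocale finite_real_product law Box
proof -
  have prob: "prob_space (law b)" for b
    using instance_P by (auto simp: law_def pandora_instance_def intro: prob_space_return)
  show "finite_real_product law Box"
    unfolding finite_real_product_def finite_real_product_axioms_def
    using instance_P finite_boxes
    by (auto intro!: product_prob_spaceI prob simp: law_def pandora_instance_def)
qed

lemma value_measure_eq: "value_measure P = W"
  unfolding value_measure_def by (rule PiM_cong) (auto simp: law_def)

lemma component_meas [measurable]: "b \<in> Box \<Longrightarrow> (\<lambda>v. v b) \<in> borel_measurable W"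
  using measurable_component_singleton[of b Box law] by (simp cong: measurable_cong_sets add: sets_M)

lemma component_integrable: "b \<in> Box \<Longrightarrow> integrable W (\<lambda>v. v b)"
proof -
  assume b: "b \<in> Box"
  have "integrable (distr W (law b) (\<lambda>v. v b)) (\<lambda>x. x)"
    using b instance_P by (subst PiM_component) (simp_all add: law_def pandora_instance_def)
  then show ?thesis
    using b by (subst (asm) integrable_distr_eq) (auto simp: measurable_cong_sets[OF sets_M refl])
qed

text \<open>\<open>b\<close> names both a box and the basket that opens it first; the second stage
  is \<open>prod.swap b\<close>. Letting \<open>b\<close> range over all boxes covers both
  orientations of every edge.\<close>

definition k3 :: "'v \<times> 'v \<Rightarrow> ('v \<times> 'v \<Rightarrow> real) \<Rightarrow> real" where
  "k3 b v = v b + v (prod.swap b)"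

definition k2 :: "'v \<times> 'v \<Rightarrow> ('v \<times> 'v \<Rightarrow> real) \<Rightarrow> real" where
  "k2 b v = cap (\<sigma>2 b (v b)) (k3 b v)"

definition k1 :: "'v \<times> 'v \<Rightarrow> ('v \<times> 'v \<Rightarrow> real) \<Rightarrow> real" where
  "k1 b v = cap (\<sigma>1 b) (k2 b v)"

lemma s2_meas [measurable]: "b \<in> Box \<Longrightarrow> \<sigma>2 b \<in> borel_measurable borel"
  using indices by (auto simp: are_indices_def)

lemma s2_eq:
  assumes "b \<in> Box"
  shows "(\<integral>\<^sup>+ y. e2ennreal (max 0 (ereal (x + y) - \<sigma>2 b x)) \<partial>law (prod.swap b))
    = ennreal (cost P (prod.swap b))"
  using indices assms swap_in_boxes[of b]
  by (cases b) (fastforce simp: are_indices_def kappa3_def law_def simp del: swap_in_boxes)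

lemma s2_ninf: "b \<in> Box \<Longrightarrow> \<sigma>2 b x \<noteq> -\<infinity>"
proof
  assume "b \<in> Box" "\<sigma>2 b x = -\<infinity>"
  with s2_eq[of b x] show False
    by (simp add: max_def e2ennreal_infty M.emeasure_space_1 top_neq_ennreal)
qed

lemma ereal_k2: "b \<in> Box \<Longrightarrow> ereal (k2 b v) = min (\<sigma>2 b (v b)) (ereal (k3 b v))"
  unfolding k2_def by (rule ereal_cap[OF s2_ninf])

lemma s1_eq:
  assumes "b \<in> Box"
  shows "(\<integral>\<^sup>+ v. e2ennreal (max 0 (ereal (k2 b v) - \<sigma>1 b)) \<partial>W) = ennreal (cost P b)"
  using indices assms
  by (cases b) (fastforce simp: are_indices_def ereal_k2 kappa2_def kappa3_def k3_def value_measure_eq)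

lemma s1_ninf: "b \<in> Box \<Longrightarrow> \<sigma>1 b \<noteq> -\<infinity>"
proof
  assume "b \<in> Box" "\<sigma>1 b = -\<infinity>"
  with s1_eq[of b] show False
    by (simp add: max_def e2ennreal_infty P.emeasure_space_1 top_neq_ennreal)
qed

lemma ereal_k1: "b \<in> Box \<Longrightarrow> ereal (k1 b v) = min (\<sigma>1 b) (ereal (k2 b v))"
  unfolding k1_def by (rule ereal_cap[OF s1_ninf])

lemma k2_le: "b \<in> Box \<Longrightarrow> k2 b v \<le> k3 b v"
  unfolding k2_def by (rule cap_le[OF s2_ninf])

lemma k1_le: "b \<in> Box \<Longrightarrow> k1 b v \<le> k2 b v"
  unfolding k1_def by (rule cap_le[OF s1_ninf])

lemma k3_meas [measurable]: "b \<in> Box \<Longrightarrow> k3 b \<in> borel_measurable W"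
  unfolding k3_def[abs_def] by (intro borel_measurable_add component_meas) simp_all

lemma k2_meas [measurable]: "b \<in> Box \<Longrightarrow> k2 b \<in> borel_measurable W"
  unfolding k2_def[abs_def]
  by (intro cap_meas k3_meas measurable_compose[OF component_meas s2_meas])

lemma k1_meas [measurable]: "b \<in> Box \<Longrightarrow> k1 b \<in> borel_measurable W"
  unfolding k1_def[abs_def] by (intro cap_meas k2_meas) simp_all

text \<open>The event must ignore both boxes of the edge, as \<open>k2 b\<close> depends on both
  values. On such an event the equation for \<open>\<sigma>1\<close> still gives the mean of
  \<open>k2 b - k1 b\<close>.\<close>

lemma first_cost_mean_zero:
  assumes b: "b \<in> Box" and E: "Measurable.pred W E"
    and "\<And>v y. v \<in> space W \<Longrightarrow> E (v(b := y)) = E v"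
    and "\<And>v y. v \<in> space W \<Longrightarrow> E (v(prod.swap b := y)) = E v"
  shows "integrable W (\<lambda>v. of_bool (E v) * (cost P b - (k2 b v - k1 b v)))"
    and "(\<integral>v. of_bool (E v) * (cost P b - (k2 b v - k1 b v)) \<partial>W) = 0"
proof -
  define g where "g x y = ennreal (cap (\<sigma>2 b x) (x + y) - cap (\<sigma>1 b) (cap (\<sigma>2 b x) (x + y)))" for x y
  have g: "ennreal (k2 b v - k1 b v) = g (v b) (v (prod.swap b))" for v
    by (simp add: g_def k1_def k2_def k3_def)
  have [measurable]: "\<sigma>2 b \<in> borel_measurable borel" using b by simp
  have eq: "(\<integral>\<^sup>+ v. of_bool (E v) * ennreal (k2 b v - k1 b v) \<partial>W)
      = ennreal (cost P b) * emeasure W {v \<in> space W. E v}"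
    unfolding g
  proof (rule nn_integral_indep_two)
    show "(\<lambda>(x, y). g x y) \<in> borel_measurable (borel \<Otimes>\<^sub>M borel)"
      unfolding g_def by measurable
    show "(\<integral>\<^sup>+ v. g (v b) (v (prod.swap b)) \<partial>W) = ennreal (cost P b)"
      unfolding g[symmetric] using s1_eq[OF b] excess_eq_cap[OF s1_ninf[OF b]]
      by (simp add: k1_def)
    show "b \<noteq> prod.swap b" using swap_neq[OF b] by simp
  qed (use assms in auto)
  show "integrable W (\<lambda>v. of_bool (E v) * (cost P b - (k2 b v - k1 b v)))"
    and "(\<integral>v. of_bool (E v) * (cost P b - (k2 b v - k1 b v)) \<partial>W) = 0"
    using mean_zero[OF _ E _ cost_nonneg[OF b] eq] b k1_le[OF b] by auto
qed

text \<open>Here \<open>E\<close> may depend on the value of \<open>b\<close>: the equation for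
  \<open>\<sigma>2\<close> holds for every observed value, with only the value of the partner
  averaged.\<close>

lemma second_cost_mean_zero:
  assumes b: "b \<in> Box" and E: "Measurable.pred W E"
    and inv: "\<And>v y. v \<in> space W \<Longrightarrow> E (v(prod.swap b := y)) = E v"
  shows "integrable W (\<lambda>v. of_bool (E v) * (cost P (prod.swap b) - (k3 b v - k2 b v)))"
    and "(\<integral>v. of_bool (E v) * (cost P (prod.swap b) - (k3 b v - k2 b v)) \<partial>W) = 0"
proof -
  have eq: "(\<integral>\<^sup>+ v. of_bool (E v) * ennreal (k3 b v - k2 b v) \<partial>W)
      = ennreal (cost P (prod.swap b)) * emeasure W {v \<in> space W. E v}"
  proof (rule nn_integral_indep_one[of "prod.swap b"])
    show "(\<integral>\<^sup>+ y. ennreal (k3 b (v(prod.swap b := y)) - k2 b (v(prod.swap b := y))) \<partial>law (prod.swap b))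
        = ennreal (cost P (prod.swap b))" for v
      using s2_eq[OF b, of "v b"] excess_eq_cap[OF s2_ninf[OF b]] swap_neq[OF b]
      by (simp add: k2_def k3_def)
  qed (use b E inv in auto)
  show "integrable W (\<lambda>v. of_bool (E v) * (cost P (prod.swap b) - (k3 b v - k2 b v)))"
    and "(\<integral>v. of_bool (E v) * (cost P (prod.swap b) - (k3 b v - k2 b v)) \<partial>W) = 0"
    using mean_zero[OF _ E _ _ eq] b cost_nonneg k2_le[OF b] by auto
qed

text \<open>The sure event in the two cost lemmas gives two integrable differences; adding
  \<open>k3 b\<close> minus both costs telescopes to \<open>k1 b\<close>.\<close>

lemma k1_integrable:
  assumes b: "b \<in> Box"
  shows "integrable W (k1 b)"
proof -
  have 1: "integrable W (\<lambda>v. cost P b - (k2 b v - k1 b v))"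
    using first_cost_mean_zero(1)[OF b, of "\<lambda>_. True"] by simp
  have 2: "integrable W (\<lambda>v. cost P (prod.swap b) - (k3 b v - k2 b v))"
    using second_cost_mean_zero(1)[OF b, of "\<lambda>_. True"] by simp
  have 3: "integrable W (\<lambda>v. k3 b v - (cost P b + cost P (prod.swap b)))"
    unfolding k3_def using b
    by (intro Bochner_Integration.integrable_diff Bochner_Integration.integrable_add component_integrable)
      simp_all
  show ?thesis
    using Bochner_Integration.integrable_add[OF Bochner_Integration.integrable_add[OF 1 2] 3]
    by (simp add: algebra_simps)
qed

end

locale pandora_exploration = pandora_indices P \<sigma>1 \<sigma>2 +
  exploration "Pi\<^sub>M (boxes P) (pandora_indices.law P)" X x0 F opn
  for P :: "'v pandora" and \<sigma>1 \<sigma>2 and X :: "'x set" and x0 F opn +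
  assumes opn_boxes: "\<And>x. x \<in> X \<Longrightarrow> opn x \<subseteq> boxes P"
begin

text \<open>
  \<open>first b\<close>: box \<open>b\<close> is opened before its partner is. \<open>second b\<close>: the partner of \<open>b\<close> is opened
  after \<open>b\<close>.
\<close>

definition first :: "'v \<times> 'v \<Rightarrow> ('v \<times> 'v \<Rightarrow> real) \<Rightarrow> bool" where
  "first b = opens {b, prod.swap b} (\<lambda>x x'. b \<in> opn x')"

definition second :: "'v \<times> 'v \<Rightarrow> ('v \<times> 'v \<Rightarrow> real) \<Rightarrow> bool" where
  "second b = opens {prod.swap b} (\<lambda>x x'. b \<in> opn x \<and> prod.swap b \<in> opn x')"

section \<open>The order of opening within an edge\<close>

lemma first_opened: "first b v \<Longrightarrow> opened b v"
  by (auto simp: first_def opens_def opened_def)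

lemma second_opened: "second b v \<Longrightarrow> opened (prod.swap b) v"
  by (auto simp: second_def opens_def opened_def)

lemma opened_cases: "opened b v \<Longrightarrow> first b v \<or> second (prod.swap b) v"
  by (erule opening_time) (auto simp: first_def second_def opens_def)

lemma first_second_exclusive: "v \<in> space W \<Longrightarrow> first b v \<Longrightarrow> \<not> second (prod.swap b) v"
  using opening_time_unique[of v b] by (fastforce simp: first_def second_def opens_def)

text \<open>If one box were opened in an earlier step, the other would not find its partner closed.
  So both would be opened in the same step, but a step opens at most one box.\<close>

lemma first_swap_exclusive:
  assumes v: "v \<in> space W" and b: "b \<in> Box" and "first b v"
  shows "\<not> first (prod.swap b) v"
proof
  assume "first (prod.swap b) v"
  with assms obtain n m where
    n: "b \<notin> opn (state n v)" "prod.swap b \<notin> opn (state n v)" "b \<in> opn (state (Suc n) v)" and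
    m: "b \<notin> opn (state m v)" "prod.swap b \<notin> opn (state m v)" "prod.swap b \<in> opn (state (Suc m) v)"
    by (auto simp: first_def opens_def)
  have "\<not> Suc n \<le> m" "\<not> Suc m \<le> n"
    using opn_mono[OF v, of "Suc n" m] opn_mono[OF v, of "Suc m" n] n m by auto
  then have "n = m" by simp
  then show False
    using single[OF v state_in[OF v], of b n "prod.swap b"] n m swap_neq[OF b] by (simp add: state_Suc)
qed

lemma second_imp_first:
  assumes "v \<in> space W" "second b v"
  shows "first b v"
proof -
  from assms obtain n where n: "b \<in> opn (state n v)" "prod.swap b \<notin> opn (state n v)"
    by (auto simp: second_def opens_def)
  then have "opened b v" by (auto simp: opened_def)
  then obtain m where m: "b \<notin> opn (state m v)" "b \<in> opn (state (Suc m) v)" by (rule opening_time)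
  have "m \<le> n" using opn_mono[OF assms(1), of n m] m n by (metis nat_le_linear subsetD)
  then have "prod.swap b \<notin> opn (state m v)" using opn_mono[OF assms(1)] n by blast
  with m show ?thesis by (auto simp: first_def opens_def)
qed

lemma both_opened_first:
  assumes "v \<in> space W" "opened b v" "opened (prod.swap b) v"
  shows "first b v \<or> first (prod.swap b) v"
  using opened_cases[OF assms(2)] second_imp_first[OF assms(1)] by blast

lemma both_opened_second:
  assumes "v \<in> space W" "b \<in> Box" "first b v" "opened (prod.swap b) v"
  shows "second b v"
  using opened_cases[OF assms(4)] first_swap_exclusive[OF assms(1-3)] by simp

text \<open>The difference between the actual costs and the amounts by which they are replaced.\<close>

definition slack :: "('v \<times> 'v \<Rightarrow> real) \<Rightarrow> real" where
  "slack v = (\<Sum>b \<in> Box. of_bool (first b v) * (cost P b - (k2 b v - k1 b v))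
     + of_bool (second b v) * (cost P (prod.swap b) - (k3 b v - k2 b v)))"

text \<open>At the time described by \<open>first b\<close> neither box of the edge is open, and at
  that of \<open>second b\<close> the partner is closed. Changing the hidden values thus leaves
  these events alone, and the cost lemmas apply term by term.\<close>

lemma slack_mean_zero: "integrable W slack" "(\<integral>v. slack v \<partial>W) = 0"
proof -
  have 1: "integrable W (\<lambda>v. of_bool (first b v) * (cost P b - (k2 b v - k1 b v)))"
    "(\<integral>v. of_bool (first b v) * (cost P b - (k2 b v - k1 b v)) \<partial>W) = 0" if "b \<in> Box" for b
  proof -
    have "first b (v(b := y)) = first b v" "first b (v(prod.swap b := y)) = first b v"
      if "v \<in> space W" for v y
      unfolding first_def by (rule opens_cong; use upd_in_space that \<open>b \<in> Box\<close> in simp)+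
    then show "integrable W (\<lambda>v. of_bool (first b v) * (cost P b - (k2 b v - k1 b v)))"
    "(\<integral>v. of_bool (first b v) * (cost P b - (k2 b v - k1 b v)) \<partial>W) = 0"
      using first_cost_mean_zero[OF that, of "first b"] opens_meas by (auto simp: first_def)
  qed
  have 2: "integrable W (\<lambda>v. of_bool (second b v) * (cost P (prod.swap b) - (k3 b v - k2 b v)))"
    "(\<integral>v. of_bool (second b v) * (cost P (prod.swap b) - (k3 b v - k2 b v)) \<partial>W) = 0"
    if "b \<in> Box" for b
  proof -
    have "second b (v(prod.swap b := y)) = second b v" if "v \<in> space W" for v y
      unfolding second_def by (rule opens_cong; use upd_in_space that \<open>b \<in> Box\<close> in simp)
    then show "integrable W (\<lambda>v. of_bool (second b v) * (cost P (prod.swap b) - (k3 b v - k2 b v)))"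
    "(\<integral>v. of_bool (second b v) * (cost P (prod.swap b) - (k3 b v - k2 b v)) \<partial>W) = 0"
      using second_cost_mean_zero[OF that, of "second b"] opens_meas by (auto simp: second_def)
  qed
  show "integrable W slack"
    unfolding slack_def using 1 2
    by (intro Bochner_Integration.integrable_sum Bochner_Integration.integrable_add) auto
  show "(\<integral>v. slack v \<partial>W) = 0"
    unfolding slack_def using 1 2
    by (subst Bochner_Integration.integral_sum) (auto simp: Bochner_Integration.integral_add)
qed

text \<open>Every value and cost of an edge is booked on the basket headed by its first opened
  box.\<close>

lemma payoff_slack:
  assumes v: "v \<in> space W" and bs: "set bs = {b. opened b v}"
    and M: "\<And>b. {fst b, snd b} \<in> M \<Longrightarrow> b \<in> Box \<Longrightarrow> opened b v"
  shows "payoff P v (bs, M) + slack v = (\<Sum>b \<in> Box.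
    of_bool ({fst b, snd b} \<in> M \<and> first b v) * k3 b v
    - of_bool (first b v) * (k2 b v - k1 b v) - of_bool (second b v) * (k3 b v - k2 b v))"
proof -
  let ?A = "\<lambda>b. {fst b, snd b} \<in> M"
  have swp: "(\<Sum>b \<in> Box. f (prod.swap b)) = (\<Sum>b \<in> Box. f b)" for f :: "'v \<times> 'v \<Rightarrow> real"
    by (rule sum.reindex_bij_witness[of _ prod.swap prod.swap]) auto
  have Asw: "?A (prod.swap b) = ?A b" for b by (simp add: insert_commute)
  have "payoff P v (bs, M) = (\<Sum>b \<in> Box. of_bool (?A b) * v b - of_bool (opened b v) * cost P b)"
    by (simp add: payoff_def bs case_prod_beta)
  also have "\<dots> = (\<Sum>b \<in> Box. of_bool (?A b \<and> first b v) * v b - of_bool (first b v) * cost P b)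
     + (\<Sum>b \<in> Box. of_bool (?A b \<and> first (prod.swap b) v) * v b - of_bool (second (prod.swap b) v) * cost P b)"
    \<comment> \<open>An opened box is exactly one of first and second on its edge. A matched edge
      has both boxes open, so exactly one of them is first.\<close>
    unfolding sum.distrib[symmetric]
  proof (rule sum.cong[OF refl])
    fix b assume b: "b \<in> Box"
    have "of_bool (opened b v) = of_bool (first b v) + (of_bool (second (prod.swap b) v) :: real)"
      using opened_cases[of b v] first_opened[of b v] second_opened[of "prod.swap b" v]
        first_second_exclusive[OF v, of b] by auto
    moreover have "of_bool (?A b) = of_bool (?A b \<and> first b v) + (of_bool (?A b \<and> first (prod.swap b) v) :: real)"
      using both_opened_first[OF v, of b] first_swap_exclusive[OF v b] M[of b] M[of "prod.swap b"] b Asw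
      by auto
    ultimately show "of_bool (?A b) * v b - of_bool (opened b v) * cost P b
      = of_bool (?A b \<and> first b v) * v b - of_bool (first b v) * cost P b
        + (of_bool (?A b \<and> first (prod.swap b) v) * v b - of_bool (second (prod.swap b) v) * cost P b)"
      by (simp only: distrib_right)
  qed
  \<comment> \<open>Reindexing by \<open>prod.swap\<close> moves the second-box terms to the basket
    of the first box.\<close>
  also have "(\<Sum>b \<in> Box. of_bool (?A b \<and> first (prod.swap b) v) * v b - of_bool (second (prod.swap b) v) * cost P b)
     = (\<Sum>b \<in> Box. of_bool (?A b \<and> first b v) * v (prod.swap b) - of_bool (second b v) * cost P (prod.swap b))"
    by (subst swp[symmetric]) (simp add: insert_commute)
  finally show ?thesis
    by (simp add: slack_def sum.distrib[symmetric] sum_subtractf[symmetric] k3_def algebra_simps)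
qed

text \<open>On a matched edge both differences are paid and \<open>k3\<close> telescopes down to
  \<open>k1\<close>; on an unmatched edge nonnegative differences are subtracted from 0.\<close>

lemma payoff_slack_le:
  assumes v: "v \<in> space W" and bs: "set bs = {b. opened b v}"
    and M: "\<And>b. {fst b, snd b} \<in> M \<Longrightarrow> b \<in> Box \<Longrightarrow> opened b v"
  shows "payoff P v (bs, M) + slack v \<le> (\<Sum>b \<in> Box. of_bool ({fst b, snd b} \<in> M \<and> first b v) * k1 b v)"
proof (rule order_trans[OF eq_refl[OF payoff_slack[OF assms]] sum_mono])
  fix b assume b: "b \<in> Box"
  have "{fst b, snd b} \<in> M \<Longrightarrow> first b v \<Longrightarrow> second b v"
    using both_opened_second[OF v b] M[of "prod.swap b"] b by (simp add: insert_commute)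
  then show "of_bool ({fst b, snd b} \<in> M \<and> first b v) * k3 b v
    - of_bool (first b v) * (k2 b v - k1 b v) - of_bool (second b v) * (k3 b v - k2 b v)
    \<le> of_bool ({fst b, snd b} \<in> M \<and> first b v) * k1 b v"
    using k1_le[OF b, of v] k2_le[OF b, of v] by auto
qed

end

section \<open>Greedy matchings\<close>

lemma swap_inject [simp]: "prod.swap a = prod.swap b \<longleftrightarrow> a = b"
  by (cases a; cases b) auto

abbreviation edge :: "'v \<times> 'v \<Rightarrow> 'v set" where
  "edge b \<equiv> {fst b, snd b}"

text \<open>A charging argument: each nonnegative member of \<open>T\<close> charges an incident
  member of \<open>G\<close> of at least its weight, and negative members need no charge.\<close>

lemma matching_le_twice_dominating:
  fixes w :: "'v \<times> 'v \<Rightarrow> real"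
  assumes fin: "finite Ori" and sub: "G \<subseteq> Ori" "T \<subseteq> Ori"
    and nonneg: "\<And>g. g \<in> G \<Longrightarrow> 0 \<le> w g"
    and dom: "\<And>b. b \<in> Ori \<Longrightarrow> 0 \<le> w b \<Longrightarrow> \<exists>g \<in> G. edge b \<inter> edge g \<noteq> {} \<and> w b \<le> w g"
    and disj: "\<And>b d. b \<in> T \<Longrightarrow> d \<in> T \<Longrightarrow> b \<noteq> d \<Longrightarrow> edge b \<inter> edge d = {}"
  shows "sum w T \<le> 2 * sum w G"
proof -
  have finT: "finite T" and finG: "finite G" using fin sub finite_subset by auto
  let ?inc = "\<lambda>b g. edge b \<inter> edge g \<noteq> {}"
  \<comment> \<open>Charging all incident members of \<open>G\<close> avoids choosing one; their
    weights are nonnegative, so the sum only grows.\<close>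
  have "w b \<le> (\<Sum>g \<in> G. of_bool (?inc b g) * w g)" if b: "b \<in> T" for b
  proof (cases "0 \<le> w b")
    case True
    with dom b sub obtain g where g: "g \<in> G" "?inc b g" "w b \<le> w g" by blast
    have "w b \<le> of_bool (?inc b g) * w g" using g by simp
    also have "\<dots> \<le> (\<Sum>g \<in> G. of_bool (?inc b g) * w g)"
      using g finG nonneg by (intro member_le_sum) auto
    finally show ?thesis .
  next
    case False
    have "0 \<le> (\<Sum>g \<in> G. of_bool (?inc b g) * w g)"
      using nonneg by (intro sum_nonneg) auto
    with False show ?thesis by linarith
  qed
  then have "sum w T \<le> (\<Sum>b \<in> T. \<Sum>g \<in> G. of_bool (?inc b g) * w g)" by (rule sum_mono)
  also have "\<dots> = (\<Sum>g \<in> G. (\<Sum>b \<in> T. of_bool (?inc b g)) * w g)"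
    by (subst sum.swap) (simp add: sum_distrib_right)
  also have "\<dots> \<le> (\<Sum>g \<in> G. 2 * w g)"
  proof (rule sum_mono)
    fix g assume g: "g \<in> G"
    \<comment> \<open>Members of \<open>T\<close> are disjoint, so each of the two endpoints of
      \<open>g\<close> accounts for at most one charge. This is the source of the factor 2.\<close>
    have one: "card {b \<in> T. u \<in> edge b} \<le> 1" for u
    proof -
      have "finite {b \<in> T. u \<in> edge b}" using finT by simp
      moreover have "\<forall>b \<in> {b \<in> T. u \<in> edge b}. \<forall>d \<in> {b \<in> T. u \<in> edge b}. b = d"
        using disj by blast
      ultimately show ?thesis
        unfolding One_nat_def by (simp only: card_le_Suc0_iff_eq)
    qed
    have "(\<Sum>b \<in> T. of_bool (?inc b g) :: real) = real (card {b \<in> T. ?inc b g})"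
      using finT by (subst sum_of_bool_eq) (simp_all only: Collect_conj_eq Collect_mem_eq)
    moreover have "card {b \<in> T. ?inc b g} \<le> card ({b \<in> T. fst g \<in> edge b} \<union> {b \<in> T. snd g \<in> edge b})"
      using finT by (intro card_mono) auto
    moreover have "\<dots> \<le> card {b \<in> T. fst g \<in> edge b} + card {b \<in> T. snd g \<in> edge b}"
      by (rule card_Un_le)
    ultimately have "(\<Sum>b \<in> T. of_bool (?inc b g) :: real) \<le> 2"
      using one[of "fst g"] one[of "snd g"] by linarith
    then show "(\<Sum>b \<in> T. of_bool (?inc b g)) * w g \<le> 2 * w g"
      using nonneg[OF g] by (rule mult_right_mono)
  qed
  finally show ?thesis by (simp add: sum_distrib_left)
qed

lemma observe_cong: "(\<And>b. b \<in> set bs \<Longrightarrow> v b = v' b) \<Longrightarrow> observe v bs = observe v' bs"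
  by (simp add: observe_def)

section \<open>Arbitrary algorithms\<close>

text \<open>An algorithm whose seed is fixed; the seed is integrated out only at the very
  end.\<close>

locale policy = pandora_indices P \<sigma>1 \<sigma>2 for P :: "'v pandora" and \<sigma>1 \<sigma>2 +
  fixes \<pi> :: "'v history \<Rightarrow> 'v action"
  assumes legal: "\<And>bs v. distinct bs \<Longrightarrow> set bs \<subseteq> boxes P \<Longrightarrow> v \<in> space W \<Longrightarrow>
      legal_action P bs (\<pi> (observe v bs))"
    and \<pi>_meas: "\<And>bs. distinct bs \<Longrightarrow> set bs \<subseteq> boxes P \<Longrightarrow>
      (\<lambda>v. \<pi> (observe v bs)) \<in> W \<rightarrow>\<^sub>M count_space UNIV"
begin

definition advance :: "('v \<times> 'v \<Rightarrow> real) \<Rightarrow> ('v \<times> 'v) list \<Rightarrow> ('v \<times> 'v) list" where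
  "advance v bs = (if is_Open (\<pi> (observe v bs)) then bs @ [next_box (\<pi> (observe v bs))] else bs)"

definition openings :: "('v \<times> 'v) list set" where
  "openings = {bs. set bs \<subseteq> Box \<and> distinct bs}"

lemma advance_in:
  assumes "v \<in> space W" "bs \<in> openings"
  shows "advance v bs \<in> openings"
  using legal[of bs v] assms
  by (cases "\<pi> (observe v bs)") (auto simp: advance_def openings_def)

sublocale pandora_exploration P \<sigma>1 \<sigma>2 openings "[]" advance set
proof unfold_locales
  show "countable openings"
    unfolding openings_def by (intro countable_finite finite_subset_distinct finite_boxes)
  show "advance v bs = advance v' bs" if "\<And>b. b \<in> set bs \<Longrightarrow> v b = v' b" for v v' bs
    using observe_cong[of bs v v'] that by (simp add: advance_def)
  show "(\<lambda>v. advance v bs) \<in> W \<rightarrow>\<^sub>M count_space openings" if bs: "bs \<in> openings" for bs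
  proof -
    have "(\<lambda>v. advance v bs) \<in> W \<rightarrow>\<^sub>M count_space UNIV"
      unfolding advance_def using bs
      by (intro measurable_compose[OF \<pi>_meas, where g = "\<lambda>a. if is_Open a then bs @ [next_box a] else bs"])
        (auto simp: openings_def)
    then show ?thesis
      by (rule measurable_count_space_extend[OF subset_UNIV, rotated])
        (rule funcsetI, rule advance_in[OF _ bs])
  qed
qed (auto simp: openings_def advance_def dest: advance_in[unfolded openings_def] split: if_splits)

text \<open>Each opening lengthens a duplicate-free list of boxes, so the loop exits. From then on
  the iteration is constant, hence the boxes ever opened are those of the final list.\<close>

lemma run_final:
  assumes v: "v \<in> space W"
  obtains bs M where "run_algorithm \<pi> v = (bs, M)" "set bs = {b. opened b v}"
    "is_matching P M" "\<And>b. edge b \<in> M \<Longrightarrow> b \<in> set bs"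
proof -
  let ?b = "\<lambda>bs. is_Open (\<pi> (observe v bs))"
  let ?c = "\<lambda>bs. bs @ [next_box (\<pi> (observe v bs))]"
  have adv: "advance v = (\<lambda>s. if ?b s then ?c s else s)"
    by (simp add: fun_eq_iff advance_def)
  have "\<exists>n. \<not> ?b ((advance v ^^ n) [])"
    unfolding adv
  proof (rule eventually_exits[where I = "\<lambda>bs. bs \<in> openings" and m = "\<lambda>bs. card Box - length bs"])
    show "[] \<in> openings" by (simp add: openings_def)
    fix bs assume bs: "bs \<in> openings" and o: "?b bs"
    have *: "?c bs \<in> openings" using advance_in[OF v bs] o by (simp add: advance_def)
    then have "length (?c bs) \<le> card Box"
      using card_mono[OF finite_boxes, of "set (?c bs)"]
      unfolding openings_def mem_Collect_eq by (metis distinct_card)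
    with * show "?c bs \<in> openings \<and> card Box - length (?c bs) < card Box - length bs"
      by simp
  qed
  then obtain n where n: "\<not> ?b (state n v)" by (auto simp: state_def)
  have st: "state m v = state n v" if "n \<le> m" for m
    using that by (induction m rule: dec_induct) (use n in \<open>simp_all add: state_Suc advance_def[of v "state n v"]\<close>)
  have "set (state n v) = {b. opened b v}"
  proof -
    have "set (state m v) \<subseteq> set (state n v)" for m
      using opn_mono[OF v, of m n] st[of m] by (cases "m \<le> n") auto
    then show ?thesis unfolding opened_def by blast
  qed
  moreover have "while ?b ?c [] = state n v"
    unfolding state_def adv by (rule while_eq_funpow) (use n in \<open>simp add: state_def adv\<close>)
  moreover have leg: "legal_action P (state n v) (\<pi> (observe v (state n v)))"
    using state_in[OF v, of n] by (intro legal v) (auto simp: openings_def)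
  moreover obtain M where M: "\<pi> (observe v (state n v)) = Stop M"
    using n by (cases "\<pi> (observe v (state n v))") auto
  ultimately show ?thesis
    using that[of "state n v" M] by (auto simp: run_algorithm_def)
qed

text \<open>Adding the mean-zero \<open>slack\<close> leaves the welfare unchanged. The bound is
  required for all \<open>Q\<close> because it is used with \<open>first b v\<close>, the
  orientation produced by the run. A non-integrable payoff has integral 0, whence the assumption on
  the mean of \<open>G\<close>.\<close>

lemma welfare_le:
  assumes G: "integrable W G" "0 \<le> (\<integral>v. G v \<partial>W)"
    and bound: "\<And>v M Q. v \<in> space W \<Longrightarrow> is_matching P M \<Longrightarrow>
      (\<Sum>b \<in> Box. of_bool (edge b \<in> M \<and> Q b) * k1 b v) \<le> G v"
  shows "(\<integral>v. payoff P v (run_algorithm \<pi> v) \<partial>W) \<le> (\<integral>v. G v \<partial>W)"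
proof (cases "integrable W (\<lambda>v. payoff P v (run_algorithm \<pi> v))")
  case True
  have "(\<integral>v. payoff P v (run_algorithm \<pi> v) \<partial>W) = (\<integral>v. payoff P v (run_algorithm \<pi> v) + slack v \<partial>W)"
    using True slack_mean_zero by simp
  also have "\<dots> \<le> (\<integral>v. G v \<partial>W)"
  proof (rule integral_mono)
    fix v assume v: "v \<in> space W"
    from run_final[OF v] obtain bs M where
      r: "run_algorithm \<pi> v = (bs, M)" "set bs = {b. opened b v}" "is_matching P M"
        "\<And>b. edge b \<in> M \<Longrightarrow> b \<in> set bs" by metis
    have "payoff P v (bs, M) + slack v \<le> (\<Sum>b \<in> Box. of_bool (edge b \<in> M \<and> first b v) * k1 b v)"
      using r by (intro payoff_slack_le[OF v]) auto
    also have "\<dots> \<le> G v" using bound[OF v r(3)] .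
    finally show "payoff P v (run_algorithm \<pi> v) + slack v \<le> G v" by (simp add: r)
  qed (use True slack_mean_zero G in auto)
  finally show ?thesis .
next
  case False
  then show ?thesis using G(2) by (simp add: not_integrable_integral_eq)
qed

end

section \<open>The descending procedure\<close>

locale descending = pandora_indices P \<sigma>1 \<sigma>2 for P :: "'v pandora" and \<sigma>1 \<sigma>2 +
  fixes sel :: "'v history \<Rightarrow> ('v \<times> 'v) set \<Rightarrow> 'v \<times> 'v" and Ori :: "('v \<times> 'v) set"
  assumes selection: "is_selection P \<sigma>1 \<sigma>2 sel" and orientation: "is_orientation P Ori"
begin

section \<open>Oriented baskets and their current indices\<close>

lemma Ori_boxes: "Ori \<subseteq> Box"
  using orientation by (simp add: is_orientation_def)

lemma finite_Ori: "finite Ori"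
  by (rule finite_subset[OF Ori_boxes finite_boxes])

lemma swap_notin_Ori: "b \<in> Ori \<Longrightarrow> prod.swap b \<notin> Ori"
  using orientation by (cases b) (fastforce simp: is_orientation_def)

lemma swap_in_Ori: "b \<in> Box \<Longrightarrow> b \<notin> Ori \<Longrightarrow> prod.swap b \<in> Ori"
  using orientation by (cases b) (fastforce simp: is_orientation_def)

lemma Ori_swap_neq: "b \<in> Ori \<Longrightarrow> d \<in> Ori \<Longrightarrow> prod.swap b \<noteq> d"
  using swap_notin_Ori by blast

lemma edge_inj: "b \<in> Ori \<Longrightarrow> d \<in> Ori \<Longrightarrow> edge b = edge d \<Longrightarrow> b = d"
  using Ori_swap_neq[of b d] by (cases b; cases d) (auto simp: doubleton_eq_iff)

definition cur :: "('v \<times> 'v \<Rightarrow> real) \<Rightarrow> ('v \<times> 'v) list \<Rightarrow> 'v \<times> 'v \<Rightarrow> ereal" where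
  "cur v bs b = (if b \<notin> set bs then \<sigma>1 b else if prod.swap b \<notin> set bs then \<sigma>2 b (v b) else ereal (k3 b v))"

lemma current_index_eq: "current_index \<sigma>1 \<sigma>2 (observe v bs) = cur v bs"
proof
  fix b :: "'v \<times> 'v"
  have "map_of (observe v bs) = (Some \<circ> v) |` set bs"
    unfolding observe_def by (rule map_of_map_restrict)
  then show "current_index \<sigma>1 \<sigma>2 (observe v bs) b = cur v bs b"
    by (cases b) (simp add: current_index_def cur_def k3_def kappa3_def restrict_map_def)
qed

lemma cur_meas: "b \<in> Box \<Longrightarrow> (\<lambda>v. cur v bs b) \<in> borel_measurable W"
  unfolding cur_def
  by (auto intro!: measurable_compose[OF component_meas s2_meas] measurable_If k3_meas borel_measurable_ereal)

text \<open>The current index is always one of the three indices whose minimum is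
  \<open>k1 b v\<close>.\<close>

lemma k1_le_cur: "b \<in> Box \<Longrightarrow> ereal (k1 b v) \<le> cur v bs b"
  unfolding cur_def by (simp add: ereal_k1 ereal_k2 min_le_iff_disj)

section \<open>The procedure as an exploration\<close>

abbreviation "continues \<equiv> descending_continues \<sigma>1 \<sigma>2"
abbreviation "step \<equiv> descending_step sel"

definition advance :: "('v \<times> 'v \<Rightarrow> real) \<Rightarrow> 'v state \<Rightarrow> 'v state" where
  "advance v x = (if continues v x then step v x else x)"

definition opn :: "'v state \<Rightarrow> ('v \<times> 'v) set" where
  "opn x = set (fst x)"

definition states :: "'v state set" where
  "states = {bs. set bs \<subseteq> Box \<and> distinct bs} \<times> Pow Ori \<times> Pow (edges P)"

lemma sel_max:
  assumes "S \<noteq> {}" "S \<subseteq> Ori"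
  shows "sel (observe v bs) S \<in> S" "d \<in> S \<Longrightarrow> cur v bs d \<le> cur v bs (sel (observe v bs) S)"
  using selection assms Ori_boxes
  unfolding is_selection_def current_index_eq[symmetric] by blast+

lemma continues_iff:
  assumes "S \<subseteq> Ori"
  shows "continues v (bs, S, M) \<longleftrightarrow> S \<noteq> {} \<and> \<not> (\<forall>d \<in> S. cur v bs d < 0)"
proof -
  have "finite S" by (rule finite_subset[OF assms finite_Ori])
  then show ?thesis
    by (cases "S = {}") (simp_all add: descending_continues_def current_index_eq Max_less_iff)
qed

lemma continues_sel:
  assumes "S \<subseteq> Ori" "continues v (bs, S, M)"
  shows "sel (observe v bs) S \<in> S" "0 \<le> cur v bs (sel (observe v bs) S)"
    "\<And>d. d \<in> S \<Longrightarrow> cur v bs d \<le> cur v bs (sel (observe v bs) S)"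
proof -
  have S: "S \<noteq> {}" "\<exists>d \<in> S. 0 \<le> cur v bs d"
    using assms by (auto simp: continues_iff not_less)
  show "sel (observe v bs) S \<in> S"
    "\<And>d. d \<in> S \<Longrightarrow> cur v bs d \<le> cur v bs (sel (observe v bs) S)"
    using sel_max[OF S(1) assms(1)] by auto
  then show "0 \<le> cur v bs (sel (observe v bs) S)"
    using S(2) order_trans by blast
qed

lemma step_eq:
  "step v (bs, S, M) = (let b = sel (observe v bs) S in
     if b \<notin> set bs then (bs @ [b], S, M)
     else if prod.swap b \<notin> set bs then (bs @ [prod.swap b], S, M)
     else (bs, {d \<in> S. edge d \<inter> edge b = {}}, insert (edge b) M))"
  by (cases "sel (observe v bs) S") (auto simp: descending_step_def)

lemma edge_in: "b \<in> Box \<Longrightarrow> edge b \<in> edges P"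
  by (auto simp: boxes_def)

lemma step_in:
  assumes "x \<in> states" "continues v x"
  shows "step v x \<in> states"
proof -
  obtain bs S M where x: "x = (bs, S, M)" by (cases x)
  have S: "S \<subseteq> Ori" "set bs \<subseteq> Box" "distinct bs" "M \<subseteq> edges P"
    using assms(1) unfolding x states_def by auto
  define b where "b = sel (observe v bs) S"
  have "b \<in> S"
    using continues_sel(1)[OF S(1)] assms(2) unfolding x b_def by blast
  then have b: "b \<in> Box" "edge b \<in> edges P"
    using S Ori_boxes edge_in by blast+
  show ?thesis
    using S b unfolding x step_eq Let_def b_def[symmetric] states_def
    by (auto simp del: insert_subset)
qed

lemma advance_in: "x \<in> states \<Longrightarrow> advance v x \<in> states"
  by (simp add: advance_def step_in)

sublocale pandora_exploration P \<sigma>1 \<sigma>2 states "([], Ori, {})" advance opn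
proof unfold_locales
  show "countable states"
    unfolding states_def
    using finite_boxes finite_edges finite_Ori
    by (intro countable_finite finite_cartesian_product finite_subset_distinct) simp_all
  show "advance v x = advance v' x" if "\<And>b. b \<in> opn x \<Longrightarrow> v b = v' b" for v v' x
    using observe_cong[of "fst x" v v'] that
    by (cases x) (simp add: advance_def opn_def descending_continues_def descending_step_def)
  show "(\<lambda>v. advance v x) \<in> W \<rightarrow>\<^sub>M count_space states" if x: "x \<in> states" for x
  proof -
    obtain bs S M where xe: "x = (bs, S, M)" by (cases x)
    have S: "S \<subseteq> Ori" and bs: "distinct bs" "set bs \<subseteq> Box" using x by (auto simp: states_def xe)
    have finS: "finite S" by (rule finite_subset[OF S finite_Ori])
    have "(\<lambda>v. advance v x) \<in> W \<rightarrow>\<^sub>M count_space UNIV"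
    proof (cases "S = {}")
      case True
      then show ?thesis by (simp add: advance_def xe descending_continues_def)
    next
      case False
      have [measurable]: "(\<lambda>v. sel (observe v bs) S) \<in> W \<rightarrow>\<^sub>M count_space UNIV"
        using selection False S Ori_boxes bs by (simp add: is_selection_def value_measure_eq)
      have "(\<lambda>v. step v (bs, S, M)) \<in> W \<rightarrow>\<^sub>M count_space UNIV"
        unfolding descending_step_def prod.case
        by (rule measurable_compose[OF \<open>(\<lambda>v. sel (observe v bs) S) \<in> _\<close>]) simp
      moreover have "Measurable.pred W (\<lambda>v. continues v (bs, S, M))"
        unfolding continues_iff[OF S] using S Ori_boxes
        by (intro pred_intros_logic pred_intros_finite finS borel_measurable_pred_less cur_meas) auto
      ultimately show ?thesis
        unfolding advance_def xe by (intro measurable_If) auto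
    qed
    then show ?thesis
      by (rule measurable_count_space_extend[OF subset_UNIV, rotated])
        (rule funcsetI, rule advance_in[OF x])
  qed
  show "opn x \<subseteq> opn (advance v x)" for v x
    by (cases x) (auto simp: advance_def opn_def step_eq Let_def)
  show "a = a'" if "a \<in> opn (advance v x) - opn x" "a' \<in> opn (advance v x) - opn x" for v x a a'
    using that by (cases x) (auto simp: advance_def opn_def step_eq Let_def split: if_splits)
qed (use advance_in in \<open>auto simp: states_def opn_def\<close>)

section \<open>The loop invariant\<close>

lemma k2_le_cur: "b \<in> Box \<Longrightarrow> b \<in> set bs \<Longrightarrow> ereal (k2 b v) \<le> cur v bs b"
  using k2_le[of b v] min.cobounded1[of "\<sigma>2 b (v b)" "ereal (k3 b v)"] ereal_k2[of b v]
  by (simp add: cur_def)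

text \<open>
  An opened basket whose index has risen above the threshold \<open>t\<close> at which it was advanced is
  urgent: all its competitors are still at most \<open>t\<close>, so it is selected next.
\<close>

definition urgent :: "('v \<times> 'v \<Rightarrow> real) \<Rightarrow> 'v state \<Rightarrow> 'v \<times> 'v \<Rightarrow> ereal \<Rightarrow> bool" where
  "urgent v = (\<lambda>(bs, S, M) b t. b \<in> S \<and> (\<forall>d \<in> S - {b}. cur v bs d \<le> t))"

text \<open>
  The third conjunct is what makes the procedure greedy for \<open>k1\<close>: whenever a basket was advanced
  its index was the largest, hence it bounds \<open>k1\<close> of everything that remains.
\<close>

definition invariant :: "('v \<times> 'v \<Rightarrow> real) \<Rightarrow> 'v state \<Rightarrow> bool" where
  "invariant v = (\<lambda>(bs, S, M). S \<subseteq> Ori \<and>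
     (\<forall>b \<in> Ori. (prod.swap b \<in> set bs \<longrightarrow> b \<in> set bs \<and> 0 \<le> \<sigma>2 b (v b)) \<and>
       (b \<in> set bs \<longrightarrow> 0 \<le> \<sigma>1 b) \<and>
       (edge b \<in> M \<longrightarrow> prod.swap b \<in> set bs \<and> 0 \<le> k1 b v)) \<and>
     (\<forall>b \<in> S. \<forall>d \<in> S. (b \<in> set bs \<longrightarrow> ereal (k1 d v) \<le> \<sigma>1 b) \<and>
       (prod.swap b \<in> set bs \<longrightarrow> ereal (k1 d v) \<le> \<sigma>2 b (v b))) \<and>
     (\<forall>d \<in> Ori - S. \<exists>b \<in> Ori. edge b \<in> M \<and> edge d \<inter> edge b \<noteq> {} \<and> k1 d v \<le> k1 b v) \<and>
     (\<forall>b \<in> Ori. edge b \<notin> M \<longrightarrow>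
       (b \<in> set bs \<and> \<sigma>1 b < ereal (k2 b v) \<longrightarrow> urgent v (bs, S, M) b (\<sigma>1 b)) \<and>
       (prod.swap b \<in> set bs \<and> \<sigma>2 b (v b) < ereal (k3 b v) \<longrightarrow> urgent v (bs, S, M) b (\<sigma>2 b (v b)))))"

text \<open>Distinct baskets of an orientation share no box, so advancing one leaves the indices of
  the others alone.\<close>

lemma cur_append:
  assumes "b \<in> Ori" "d \<in> Ori" "d \<noteq> b"
  shows "cur v (bs @ [b]) d = cur v bs d" "cur v (bs @ [prod.swap b]) d = cur v bs d"
proof -
  have "d \<noteq> prod.swap b" "prod.swap d \<noteq> b" "prod.swap d \<noteq> prod.swap b"
    using assms Ori_swap_neq[of b d] Ori_swap_neq[of d b] by auto
  then show "cur v (bs @ [b]) d = cur v bs d" "cur v (bs @ [prod.swap b]) d = cur v bs d"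
    using assms by (simp_all add: cur_def)
qed

lemma invariant_step:
  assumes inv: "invariant v (bs, S, M)" and cont: "continues v (bs, S, M)"
  shows "invariant v (step v (bs, S, M))"
proof -
  have S: "S \<subseteq> Ori"
    and second: "\<And>b. b \<in> Ori \<Longrightarrow> prod.swap b \<in> set bs \<Longrightarrow> b \<in> set bs \<and> 0 \<le> \<sigma>2 b (v b)"
    and fst: "\<And>b. b \<in> Ori \<Longrightarrow> b \<in> set bs \<Longrightarrow> 0 \<le> \<sigma>1 b"
    and M: "\<And>b. b \<in> Ori \<Longrightarrow> edge b \<in> M \<Longrightarrow> prod.swap b \<in> set bs \<and> 0 \<le> k1 b v"
    and past1: "\<And>b d. b \<in> S \<Longrightarrow> d \<in> S \<Longrightarrow> b \<in> set bs \<Longrightarrow> ereal (k1 d v) \<le> \<sigma>1 b"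
    and past2: "\<And>b d. b \<in> S \<Longrightarrow> d \<in> S \<Longrightarrow> prod.swap b \<in> set bs \<Longrightarrow> ereal (k1 d v) \<le> \<sigma>2 b (v b)"
    and dom: "\<And>d. d \<in> Ori \<Longrightarrow> d \<notin> S \<Longrightarrow> \<exists>b \<in> Ori. edge b \<in> M \<and> edge d \<inter> edge b \<noteq> {} \<and> k1 d v \<le> k1 b v"
    and hot1: "\<And>b. b \<in> Ori \<Longrightarrow> edge b \<notin> M \<Longrightarrow> b \<in> set bs \<Longrightarrow> \<sigma>1 b < ereal (k2 b v) \<Longrightarrow> urgent v (bs, S, M) b (\<sigma>1 b)"
    and hot2: "\<And>b. b \<in> Ori \<Longrightarrow> edge b \<notin> M \<Longrightarrow> prod.swap b \<in> set bs \<Longrightarrow> \<sigma>2 b (v b) < ereal (k3 b v) \<Longrightarrow> urgent v (bs, S, M) b (\<sigma>2 b (v b))"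
    using inv unfolding invariant_def prod.case by blast+
  define b0 where "b0 = sel (observe v bs) S"
  have b0: "b0 \<in> S" "0 \<le> cur v bs b0" and max: "\<And>d. d \<in> S \<Longrightarrow> cur v bs d \<le> cur v bs b0"
    unfolding b0_def by (rule continues_sel[OF S cont]; assumption)+
  have b0O: "b0 \<in> Ori" and b0B: "b0 \<in> Box" using b0 S Ori_boxes by auto
  have SB: "\<And>d. d \<in> S \<Longrightarrow> d \<in> Box" using S Ori_boxes by auto
  have max1: "\<And>d. d \<in> S \<Longrightarrow> ereal (k1 d v) \<le> cur v bs b0"
    using max k1_le_cur SB order_trans by blast
  \<comment> \<open>An urgent basket whose index exceeds the threshold strictly beats all
    competitors. Hence, by \<open>h1\<close> and \<open>h2\<close> below, any pending rise on an
    unmatched edge belongs to the selected basket.\<close>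
  have sel_urgent: "b = b0" if "urgent v (bs, S, M) b t" "t < cur v bs b" for b t
  proof (rule ccontr)
    assume "b \<noteq> b0"
    then have "cur v bs b0 \<le> t" "b \<in> S" using that b0 by (auto simp: urgent_def)
    then show False using that(2) max[of b] by simp
  qed
  have h1: "b = b0" if "b \<in> Ori" "edge b \<notin> M" "b \<in> set bs" "\<sigma>1 b < ereal (k2 b v)" for b
  proof (rule sel_urgent[OF hot1[OF that]])
    have "ereal (k2 b v) \<le> cur v bs b"
      using that Ori_boxes by (intro k2_le_cur) auto
    with that(4) show "\<sigma>1 b < cur v bs b" by simp
  qed
  have h2: "b = b0" if "b \<in> Ori" "edge b \<notin> M" "prod.swap b \<in> set bs" "\<sigma>2 b (v b) < ereal (k3 b v)" for b
    by (rule sel_urgent[OF hot2[OF that]]) (use that second[of b] in \<open>simp add: cur_def\<close>)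
  have neq: "d \<noteq> prod.swap b0" "prod.swap d \<noteq> b0" if "d \<in> Ori" for d
    using that b0O Ori_swap_neq[of b0 d] Ori_swap_neq[of d b0] by auto
  consider (A) "b0 \<notin> set bs" | (B) "b0 \<in> set bs" "prod.swap b0 \<notin> set bs"
    | (C) "b0 \<in> set bs" "prod.swap b0 \<in> set bs" by blast
  then show ?thesis
  proof cases
    case A
    have ns: "prod.swap b0 \<notin> set bs" using second[OF b0O] A by blast
    have c0: "cur v bs b0 = \<sigma>1 b0" using A by (simp add: cur_def)
    have in1: "b \<in> set (bs @ [b0]) \<longleftrightarrow> b \<in> set bs \<or> b = b0" for b by auto
    have in2: "prod.swap b \<in> set (bs @ [b0]) \<longleftrightarrow> prod.swap b \<in> set bs" if "b \<in> Ori" for b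
      using neq[OF that] by auto
    \<comment> \<open>The index of \<open>b0\<close> before the opening was the largest and becomes
      the threshold; the other indices do not move.\<close>
    have u: "urgent v (bs @ [b0], S, M) b0 (\<sigma>1 b0)"
      unfolding urgent_def prod.case
    proof (intro conjI ballI)
      fix d assume "d \<in> S - {b0}"
      then show "cur v (bs @ [b0]) d \<le> \<sigma>1 b0"
        using cur_append(1)[OF b0O, of d v bs] max[of d] c0 S by auto
    qed (fact b0)
    have "invariant v (bs @ [b0], S, M)"
      unfolding invariant_def prod.case
    proof (intro conjI ballI impI)
      fix b assume b: "b \<in> Ori"
      show "b \<in> set (bs @ [b0])" "0 \<le> \<sigma>2 b (v b)" if "prod.swap b \<in> set (bs @ [b0])"
        using that in2[OF b] second[OF b] by auto
      show "0 \<le> \<sigma>1 b" if "b \<in> set (bs @ [b0])"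
        using that fst[OF b] b0(2) c0 by auto
      show "prod.swap b \<in> set (bs @ [b0])" "0 \<le> k1 b v" if "edge b \<in> M"
        using M[OF b that] by auto
      show "urgent v (bs @ [b0], S, M) b (\<sigma>1 b)"
        if "edge b \<notin> M" "b \<in> set (bs @ [b0]) \<and> \<sigma>1 b < ereal (k2 b v)"
        using h1[OF b that(1)] that u in1 by blast
      show "urgent v (bs @ [b0], S, M) b (\<sigma>2 b (v b))"
        if "edge b \<notin> M" "prod.swap b \<in> set (bs @ [b0]) \<and> \<sigma>2 b (v b) < ereal (k3 b v)"
        using h2[OF b that(1)] that ns in2[OF b] by blast
    next
      fix b d assume bd: "b \<in> S" "d \<in> S"
      show "ereal (k1 d v) \<le> \<sigma>1 b" if "b \<in> set (bs @ [b0])"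
        using that past1[OF bd] max1[OF bd(2)] c0 by auto
      show "ereal (k1 d v) \<le> \<sigma>2 b (v b)" if "prod.swap b \<in> set (bs @ [b0])"
        using that past2[OF bd] in2[of b] bd S by auto
    qed (use S dom in auto)
    then show ?thesis using A by (simp add: step_eq b0_def[symmetric])
  next
    case B
    have c0: "cur v bs b0 = \<sigma>2 b0 (v b0)" using B by (simp add: cur_def)
    have in1: "b \<in> set (bs @ [prod.swap b0]) \<longleftrightarrow> b \<in> set bs" if "b \<in> Ori" for b
      using neq[OF that] by auto
    have in2: "prod.swap b \<in> set (bs @ [prod.swap b0]) \<longleftrightarrow> prod.swap b \<in> set bs \<or> b = b0" for b
      by auto
    have u: "urgent v (bs @ [prod.swap b0], S, M) b0 t" if "\<And>d. d \<in> S - {b0} \<Longrightarrow> cur v bs d \<le> t" for t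
      unfolding urgent_def prod.case
    proof (intro conjI ballI)
      fix d assume "d \<in> S - {b0}"
      then show "cur v (bs @ [prod.swap b0]) d \<le> t"
        using cur_append(2)[OF b0O, of d v bs] that[of d] S by auto
    qed (fact b0)
    \<comment> \<open>Urgency left over from the first opening persists, since the second opening
      changes no competitor.\<close>
    have u1: "urgent v (bs @ [prod.swap b0], S, M) b0 (\<sigma>1 b0)"
      if "edge b0 \<notin> M" "\<sigma>1 b0 < ereal (k2 b0 v)"
      using u hot1[OF b0O that(1) B(1) that(2)] by (auto simp: urgent_def)
    have u2: "urgent v (bs @ [prod.swap b0], S, M) b0 (\<sigma>2 b0 (v b0))"
      using u max c0 by auto
    have "invariant v (bs @ [prod.swap b0], S, M)"
      unfolding invariant_def prod.case
    proof (intro conjI ballI impI)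
      fix b assume b: "b \<in> Ori"
      show "b \<in> set (bs @ [prod.swap b0])" "0 \<le> \<sigma>2 b (v b)" if "prod.swap b \<in> set (bs @ [prod.swap b0])"
        using that in2[of b] second[OF b] B b0(2) c0 by auto
      show "0 \<le> \<sigma>1 b" if "b \<in> set (bs @ [prod.swap b0])"
        using that fst[OF b] in1[OF b] by auto
      show "prod.swap b \<in> set (bs @ [prod.swap b0])" "0 \<le> k1 b v" if "edge b \<in> M"
        using M[OF b that] by auto
      show "urgent v (bs @ [prod.swap b0], S, M) b (\<sigma>1 b)"
        if "edge b \<notin> M" "b \<in> set (bs @ [prod.swap b0]) \<and> \<sigma>1 b < ereal (k2 b v)"
        using h1[OF b that(1)] that u1 in1[OF b] by blast
      show "urgent v (bs @ [prod.swap b0], S, M) b (\<sigma>2 b (v b))"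
        if "edge b \<notin> M" "prod.swap b \<in> set (bs @ [prod.swap b0]) \<and> \<sigma>2 b (v b) < ereal (k3 b v)"
        using h2[OF b that(1)] that u2 in2[of b] by blast
    next
      fix b d assume bd: "b \<in> S" "d \<in> S"
      show "ereal (k1 d v) \<le> \<sigma>1 b" if "b \<in> set (bs @ [prod.swap b0])"
        using that past1[OF bd] in1[of b] bd S by auto
      show "ereal (k1 d v) \<le> \<sigma>2 b (v b)" if "prod.swap b \<in> set (bs @ [prod.swap b0])"
        using that past2[OF bd] max1[OF bd(2)] c0 in2[of b] by auto
    qed (use S dom in auto)
    then show ?thesis using B by (simp add: step_eq b0_def[symmetric])
  next
    case C
    let ?S = "{d \<in> S. edge d \<inter> edge b0 = {}}" and ?M = "insert (edge b0) M"
    have c0: "cur v bs b0 = ereal (k3 b0 v)" using C by (simp add: cur_def)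
    \<comment> \<open>The three terms are the indices at which \<open>b0\<close> was advanced. Each
      is nonnegative and bounds \<open>k1\<close> of all baskets still in \<open>S\<close>, so their
      minimum \<open>k1 b0 v\<close> does too: this is the greedy choice.\<close>
    have k1_b0: "ereal (k1 b0 v) = min (\<sigma>1 b0) (min (\<sigma>2 b0 (v b0)) (cur v bs b0))"
      using b0B by (simp add: ereal_k1 ereal_k2 c0)
    have ge0: "0 \<le> k1 b0 v"
    proof -
      have "0 \<le> ereal (k1 b0 v)"
        unfolding k1_b0 using b0(2) fst[OF b0O] second[OF b0O] C by simp
      then show ?thesis by simp
    qed
    have edge_M: "edge b \<in> ?M \<longleftrightarrow> b = b0 \<or> edge b \<in> M" if "b \<in> Ori" for b
      using edge_inj[OF that b0O] by blast
    have dom0: "k1 d v \<le> k1 b0 v" if "d \<in> S" for d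
    proof -
      have "ereal (k1 d v) \<le> ereal (k1 b0 v)"
        unfolding k1_b0 using past1[OF b0(1) that] past2[OF b0(1) that] max1[OF that] C by simp
      then show ?thesis by simp
    qed
    have "invariant v (bs, ?S, ?M)"
      unfolding invariant_def prod.case
    proof (intro conjI ballI impI)
      fix b assume b: "b \<in> Ori"
      show "b \<in> set bs" "0 \<le> \<sigma>2 b (v b)" if "prod.swap b \<in> set bs"
        using that second[OF b] by auto
      show "0 \<le> \<sigma>1 b" if "b \<in> set bs"
        using that fst[OF b] by auto
      show "prod.swap b \<in> set bs" "0 \<le> k1 b v" if "edge b \<in> ?M"
        using that M[OF b] C ge0 unfolding edge_M[OF b] by blast+
      \<comment> \<open>A pending rise would belong to \<open>b0\<close>, which is now matched, so
        the premises are contradictory; likewise for the second index.\<close>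
      show "urgent v (bs, ?S, ?M) b (\<sigma>1 b)"
        if "edge b \<notin> ?M" "b \<in> set bs \<and> \<sigma>1 b < ereal (k2 b v)"
        using h1[OF b] that unfolding edge_M[OF b] by blast
      show "urgent v (bs, ?S, ?M) b (\<sigma>2 b (v b))"
        if "edge b \<notin> ?M" "prod.swap b \<in> set bs \<and> \<sigma>2 b (v b) < ereal (k3 b v)"
        using h2[OF b] that unfolding edge_M[OF b] by blast
    next
      fix b d assume bd: "b \<in> ?S" "d \<in> ?S"
      show "ereal (k1 d v) \<le> \<sigma>1 b" if "b \<in> set bs"
        using that past1[of b d] bd by blast
      show "ereal (k1 d v) \<le> \<sigma>2 b (v b)" if "prod.swap b \<in> set bs"
        using that past2[of b d] bd by blast
    next
      fix d assume d: "d \<in> Ori - ?S"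
      show "\<exists>b \<in> Ori. edge b \<in> ?M \<and> edge d \<inter> edge b \<noteq> {} \<and> k1 d v \<le> k1 b v"
      proof (cases "d \<in> S")
        case True
        then show ?thesis using d dom0[OF True] b0O by (intro bexI[of _ b0]) blast+
      next
        case False
        then show ?thesis using d dom[of d] by blast
      qed
    qed (use S in auto)
    then show ?thesis using C by (simp add: step_eq b0_def[symmetric])
  qed
qed

lemma invariant_init: "invariant v ([], Ori, {})"
  by (simp add: invariant_def)

lemma invariant_state: "invariant v (state n v)"
proof (induction n)
  case 0
  then show ?case by (simp add: invariant_init)
next
  case (Suc n)
  obtain bs S M where x: "state n v = (bs, S, M)" by (cases "state n v")
  show ?case
    using Suc invariant_step[of v bs S M]
    by (simp add: state_Suc x advance_def[of v "(bs, S, M)"])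
qed

text \<open>The matching only grows, so this is membership in the final matching; as a countable
  union over time it is visibly measurable.\<close>

definition matched :: "'v \<times> 'v \<Rightarrow> ('v \<times> 'v \<Rightarrow> real) \<Rightarrow> bool" where
  "matched b v \<longleftrightarrow> (\<exists>n. edge b \<in> snd (snd (state n v)))"

definition greedy_weight :: "('v \<times> 'v \<Rightarrow> real) \<Rightarrow> real" where
  "greedy_weight v = (\<Sum>b \<in> Ori. of_bool (matched b v) * k1 b v)"

lemma matched_meas [measurable]: "Measurable.pred W (matched b)"
  unfolding matched_def[abs_def]
  using pred_state[of "\<lambda>x. edge b \<in> snd (snd x)"] by (intro pred_intros_countable)

lemma greedy_weight_integrable: "integrable W greedy_weight"
  unfolding greedy_weight_def[abs_def]
proof (rule Bochner_Integration.integrable_sum)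
  fix b assume "b \<in> Ori"
  then have b: "b \<in> Box" using Ori_boxes by auto
  show "integrable W (\<lambda>v. of_bool (matched b v) * k1 b v)"
  proof (rule Bochner_Integration.integrable_bound[OF k1_integrable[OF b]])
    show "(\<lambda>v. of_bool (matched b v) * k1 b v) \<in> borel_measurable W"
      using k1_meas[OF b] by measurable
  qed auto
qed

text \<open>Each iteration either opens a new box or matches the selected basket, which then leaves
  \<open>S\<close> because it meets its own edge. The number of closed boxes plus the size of
  \<open>S\<close> therefore decreases.\<close>

lemma run_final:
  assumes v: "v \<in> space W"
  obtains bs S M where "run_descending \<sigma>1 \<sigma>2 sel Ori v = (bs, M)" "invariant v (bs, S, M)"
    "\<not> continues v (bs, S, M)" "set bs = {b. opened b v}" "\<And>b. edge b \<in> M \<longleftrightarrow> matched b v"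
proof -
  have adv: "advance v = (\<lambda>x. if continues v x then step v x else x)"
    by (simp add: fun_eq_iff advance_def)
  have "\<exists>n. \<not> continues v ((advance v ^^ n) ([], Ori, {}))"
    unfolding adv
  proof (rule eventually_exits[where I = "\<lambda>x. x \<in> states"
        and m = "\<lambda>(bs, S, M). card Box - length bs + card S"])
    show "([], Ori, {}) \<in> states" by (simp add: states_def)
    fix x assume x: "x \<in> states" and c: "continues v x"
    have sx: "step v x \<in> states" by (rule step_in[OF x c])
    obtain bs S M where xe: "x = (bs, S, M)" by (cases x)
    have S: "S \<subseteq> Ori" "finite S" using x finite_subset[OF _ finite_Ori] by (auto simp: xe states_def)
    have len: "length bs' \<le> card Box" if "(bs', S', M') \<in> states" for bs' S' M'
      using that card_mono[OF finite_boxes, of "set bs'"] distinct_card[of bs']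
      by (auto simp: states_def)
    define b where "b = sel (observe v bs) S"
    have b: "b \<in> S" unfolding b_def by (rule continues_sel(1)[OF S(1) c[unfolded xe]])
    have "{d \<in> S. edge d \<inter> edge b = {}} \<subset> S" using b by blast
    then have "card {d \<in> S. edge d \<inter> edge b = {}} < card S" by (rule psubset_card_mono[OF S(2)])
    then have "(case step v x of (bs, S, M) \<Rightarrow> card Box - length bs + card S) < card Box - length bs + card S"
      using sx len[of "bs @ [b]" S M] len[of "bs @ [prod.swap b]" S M]
      unfolding xe step_eq b_def[symmetric] Let_def by (auto split: if_splits)
    then show "step v x \<in> states \<and> (case step v x of (bs, S, M) \<Rightarrow> card Box - length bs + card S)
        < (case x of (bs, S, M) \<Rightarrow> card Box - length bs + card S)"
      using sx by (simp add: xe)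
  qed
  then obtain n where n: "\<not> continues v (state n v)" by (auto simp: state_def)
  have st: "state m v = state n v" if "n \<le> m" for m
    using that by (induction m rule: dec_induct) (use n in \<open>simp_all add: state_Suc advance_def[of v "state n v"]\<close>)
  have sub: "snd (snd x) \<subseteq> snd (snd (advance v x))" for x
    by (cases x) (auto simp: advance_def step_eq Let_def)
  have mono: "snd (snd (state m v)) \<subseteq> snd (snd (state n v))" if "m \<le> n" for m
    using that by (rule lift_Suc_mono_le[of "\<lambda>n. snd (snd (state n v))", rotated]) (simp add: state_Suc sub)
  obtain bs S M where x: "state n v = (bs, S, M)" by (cases "state n v")
  show ?thesis
  proof (rule that)
    have "while (continues v) (step v) ([], Ori, {}) = state n v"
      unfolding state_def adv by (rule while_eq_funpow) (use n in \<open>simp add: state_def adv\<close>)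
    then show "run_descending \<sigma>1 \<sigma>2 sel Ori v = (bs, M)"
      by (simp add: run_descending_def x)
    show "invariant v (bs, S, M)" using invariant_state[of v n] by (simp add: x)
    show "\<not> continues v (bs, S, M)" using n by (simp add: x)
    have "opn (state m v) \<subseteq> opn (state n v)" for m
      using opn_mono[OF v, of m n] st[of m] by (cases "m \<le> n") auto
    moreover have "opn (state n v) = set bs" by (simp add: opn_def x)
    ultimately show "set bs = {b. opened b v}" unfolding opened_def by blast
    have "snd (snd (state m v)) \<subseteq> snd (snd (state n v))" for m
      using mono[of m] st[of m] by (cases "m \<le> n") auto
    moreover have "snd (snd (state n v)) = M" by (simp add: x)
    ultimately show "edge b \<in> M \<longleftrightarrow> matched b v" for b unfolding matched_def by blast
  qed
qed

section \<open>The welfare of the descending procedure\<close>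

lemma swap_opened_later:
  assumes "b \<in> Ori" "prod.swap b \<in> opn (state n v)"
  shows "b \<in> opn (state n v)"
  using invariant_state[of v n] assms
  by (cases "state n v") (simp add: invariant_def opn_def)

text \<open>By the invariant the second box of an oriented edge is never open without the first;
  opening it first would force both into one step.\<close>

lemma not_first_swap:
  assumes v: "v \<in> space W" and b: "b \<in> Ori"
  shows "\<not> first (prod.swap b) v" "\<not> second (prod.swap b) v"
proof
  assume "first (prod.swap b) v"
  then obtain n where n: "b \<notin> opn (state n v)" "prod.swap b \<notin> opn (state n v)"
    "prod.swap b \<in> opn (state (Suc n) v)"
    by (auto simp: first_def opens_def)
  moreover have "b \<in> opn (state (Suc n) v)" by (rule swap_opened_later[OF b n(3)])
  ultimately have "b = prod.swap b"
    using single[OF v state_in[OF v], of b n "prod.swap b"] by (simp add: state_Suc)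
  then show False using Ori_swap_neq[OF b b] by simp
next
  show "\<not> second (prod.swap b) v"
    using swap_opened_later[OF b] by (auto simp: second_def opens_def)
qed

text \<open>Equality holds because no index rise is pending on an unmatched edge when the procedure
  stops, so every difference charged there vanishes.\<close>

lemma payoff_slack_eq:
  assumes v: "v \<in> space W"
  shows "payoff P v (run_descending \<sigma>1 \<sigma>2 sel Ori v) + slack v = greedy_weight v"
proof -
  from run_final[OF v] obtain bs S M where
    run: "run_descending \<sigma>1 \<sigma>2 sel Ori v = (bs, M)" and inv: "invariant v (bs, S, M)"
    and stop: "\<not> continues v (bs, S, M)" and bs: "set bs = {b. opened b v}"
    and M: "\<And>b. edge b \<in> M \<longleftrightarrow> matched b v" by metis
  have S: "S \<subseteq> Ori" using inv by (simp add: invariant_def)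
  \<comment> \<open>On stopping, every basket left in \<open>S\<close> has a negative index.\<close>
  have idle: "\<not> urgent v (bs, S, M) b t" if "0 \<le> t" "t < cur v bs b" for b t
    using stop that continues_iff[OF S, of v bs M] by (auto simp: urgent_def)
  have Mb: "prod.swap b \<in> set bs \<and> b \<in> set bs" if "edge b \<in> M" "b \<in> Ori" for b
    using inv that by (simp add: invariant_def)
  have opnd: "opened b v" if "edge b \<in> M" "b \<in> Box" for b
  proof (cases "b \<in> Ori")
    case True
    then show ?thesis using Mb[OF that(1)] bs by auto
  next
    case False
    then show ?thesis using Mb[of "prod.swap b"] swap_in_Ori[OF that(2)] that(1) bs
      by (simp add: insert_commute)
  qed
  let ?t = "\<lambda>b. of_bool (edge b \<in> M \<and> first b v) * k3 b v
    - of_bool (first b v) * (k2 b v - k1 b v) - of_bool (second b v) * (k3 b v - k2 b v)"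
  have "payoff P v (bs, M) + slack v = (\<Sum>b \<in> Box. ?t b)"
    using opnd by (intro payoff_slack[OF v bs])
  also have "\<dots> = (\<Sum>b \<in> Ori. ?t b)"
  \<comment> \<open>Baskets outside \<open>Ori\<close> contribute 0, as their first box is never the
    first opened on its edge.\<close>
  proof (rule sum.mono_neutral_right[OF finite_boxes Ori_boxes], rule ballI)
    fix b assume "b \<in> Box - Ori"
    then show "?t b = 0" using not_first_swap[OF v, of "prod.swap b"] swap_in_Ori[of b] by simp
  qed
  also have "\<dots> = (\<Sum>b \<in> Ori. of_bool (matched b v) * k1 b v)"
  proof (rule sum.cong[OF refl])
    fix b assume b: "b \<in> Ori"
    then have bB: "b \<in> Box" using Ori_boxes by auto
    show "?t b = of_bool (matched b v) * k1 b v"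
    proof (cases "edge b \<in> M")
      case True
      have "opened b v" "opened (prod.swap b) v" using Mb[OF True b] bs by auto
      then have "first b v" "second b v"
        using both_opened_first[OF v, of b] not_first_swap[OF v b] both_opened_second[OF v bB] by auto
      then show ?thesis using True M[of b] by simp
    next
      case False
      \<comment> \<open>A rise above \<open>\<sigma>1 b\<close> would make \<open>b\<close> urgent
        with a nonnegative threshold, contradicting \<open>idle\<close>.\<close>
      have "k1 b v = k2 b v" if "first b v"
      proof -
        have "b \<in> set bs" using first_opened[OF that] bs by simp
        then have "\<not> \<sigma>1 b < ereal (k2 b v)"
          using inv b False idle[of "\<sigma>1 b" b] k2_le_cur[OF bB, of bs v]
          unfolding invariant_def prod.case by (meson less_le_trans)
        then have "ereal (k1 b v) = ereal (k2 b v)" unfolding ereal_k1[OF bB] by simp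
        then show ?thesis by simp
      qed
      moreover have "k2 b v = k3 b v" if "second b v"
      proof -
        have "prod.swap b \<in> set bs" using second_opened[OF that] bs by simp
        then have "\<not> \<sigma>2 b (v b) < ereal (k3 b v)"
          using inv b False idle[of "\<sigma>2 b (v b)" b]
          by (auto simp: invariant_def cur_def)
        then have "ereal (k2 b v) = ereal (k3 b v)" unfolding ereal_k2[OF bB] by simp
        then show ?thesis by simp
      qed
      ultimately show ?thesis using False M[of b] by simp
    qed
  qed
  finally show ?thesis by (simp add: run greedy_weight_def)
qed

lemma descending_welfare_eq: "descending_welfare P \<sigma>1 \<sigma>2 sel Ori = (\<integral>v. greedy_weight v \<partial>W)"
proof -
  have "descending_welfare P \<sigma>1 \<sigma>2 sel Ori = (\<integral>v. greedy_weight v - slack v \<partial>W)"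
    unfolding descending_welfare_def value_measure_eq
    by (intro Bochner_Integration.integral_cong) (auto simp: payoff_slack_eq[symmetric])
  then show ?thesis using greedy_weight_integrable slack_mean_zero by simp
qed

lemma greedy_weight_nonneg: "v \<in> space W \<Longrightarrow> 0 \<le> greedy_weight v"
proof -
  assume v: "v \<in> space W"
  from run_final[OF v] obtain bs S M where
    inv: "invariant v (bs, S, M)" and M: "\<And>b. edge b \<in> M \<longleftrightarrow> matched b v" by metis
  have "0 \<le> k1 b v" if "b \<in> Ori" "matched b v" for b
    using inv that M[of b] unfolding invariant_def prod.case by blast
  then show ?thesis unfolding greedy_weight_def by (intro sum_nonneg) auto
qed

text \<open>A basket left in \<open>S\<close> has a negative index, hence negative
  \<open>k1\<close>. All others are dominated by an incident matched basket through the invariant,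
  so the charging argument applies. \<open>Q\<close> allows any part of the matching to be
  selected.\<close>

lemma matching_weight_le:
  assumes v: "v \<in> space W" and N: "is_matching P N"
  shows "(\<Sum>b \<in> Ori. of_bool (edge b \<in> N \<and> Q b) * k1 b v) \<le> 2 * greedy_weight v"
proof -
  from run_final[OF v] obtain bs S M where
    inv: "invariant v (bs, S, M)" and stop: "\<not> continues v (bs, S, M)"
    and M: "\<And>b. edge b \<in> M \<longleftrightarrow> matched b v" by metis
  have S: "S \<subseteq> Ori" using inv by (simp add: invariant_def)
  have "sum (\<lambda>b. k1 b v) {b \<in> Ori. edge b \<in> N \<and> Q b} \<le> 2 * sum (\<lambda>b. k1 b v) {b \<in> Ori. matched b v}"
  proof (rule matching_le_twice_dominating[OF finite_Ori])
    show "0 \<le> k1 g v" if "g \<in> {b \<in> Ori. matched b v}" for g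
      using inv that M[of g] unfolding invariant_def prod.case by blast
    show "\<exists>g \<in> {b \<in> Ori. matched b v}. edge b \<inter> edge g \<noteq> {} \<and> k1 b v \<le> k1 g v"
      if b: "b \<in> Ori" "0 \<le> k1 b v" for b
    proof -
      have "b \<notin> S"
      proof
        assume "b \<in> S"
        then have "cur v bs b < 0" using stop continues_iff[OF S, of v bs M] by blast
        then have "ereal (k1 b v) < 0"
          using k1_le_cur[of b v bs] b Ori_boxes by (meson le_less_trans subsetD)
        then show False using b by simp
      qed
      then have "\<exists>g \<in> Ori. edge g \<in> M \<and> edge b \<inter> edge g \<noteq> {} \<and> k1 b v \<le> k1 g v"
        using inv b unfolding invariant_def prod.case by blast
      then show ?thesis unfolding M by blast
    qed
    show "edge b \<inter> edge d = {}"
      if "b \<in> {b \<in> Ori. edge b \<in> N \<and> Q b}" "d \<in> {b \<in> Ori. edge b \<in> N \<and> Q b}" "b \<noteq> d" for b d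
    proof -
      have "edge b \<noteq> edge d" using edge_inj[of b d] that by blast
      moreover have "disjoint N" "edge b \<in> N" "edge d \<in> N"
        using N that(1,2) by (auto simp: is_matching_def)
      ultimately show ?thesis by (intro disjointD[of N])
    qed
  qed auto
  moreover have "(\<Sum>b \<in> Ori. of_bool (R b) * k1 b v) = sum (\<lambda>b. k1 b v) {b \<in> Ori. R b}" for R
    using finite_Ori by (intro sum.mono_neutral_cong_right) auto
  ultimately show ?thesis unfolding greedy_weight_def by metis
qed

end

section \<open>The approximation guarantee\<close>

theorem theorem2:
  fixes P :: "'v pandora"
    and R :: "'s measure"
    and \<sigma>1 :: "'v \<times> 'v \<Rightarrow> ereal"
    and \<sigma>2 :: "'v \<times> 'v \<Rightarrow> real \<Rightarrow> ereal"
    and sel :: "'v history \<Rightarrow> ('v \<times> 'v) set \<Rightarrow> 'v \<times> 'v"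
    and Ori :: "('v \<times> 'v) set"
  assumes "pandora_instance P"
    and "prob_space R"
    and "are_indices P \<sigma>1 \<sigma>2"
    and "is_selection P \<sigma>1 \<sigma>2 sel"
    and "is_orientation P Ori"
  shows "ereal (best_of_two_worlds_welfare P \<sigma>1 \<sigma>2 sel Ori) \<ge> ereal (1 / 4) * opt_welfare P R"
proof -
  interpret R: prob_space R by fact
  interpret pandora_indices P \<sigma>1 \<sigma>2 by unfold_locales fact+
  interpret O: descending P \<sigma>1 \<sigma>2 sel Ori by unfold_locales fact+
  have rev: "is_orientation P (Ori\<inverse>)"
    unfolding is_orientation_def
  proof (intro conjI ballI subsetI)
    fix b assume "b \<in> Ori\<inverse>"
    then have "prod.swap b \<in> Box" using O.Ori_boxes by (cases b) auto
    then show "b \<in> Box" by (simp only: swap_in_boxes)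
  next
    fix b assume b: "b \<in> Box"
    show "case b of (i, j) \<Rightarrow> ((i, j) \<in> Ori\<inverse>) = ((j, i) \<notin> Ori\<inverse>)"
      using O.swap_notin_Ori[of b] O.swap_in_Ori[OF b] by (cases b) auto
  qed
  interpret O': descending P \<sigma>1 \<sigma>2 sel "Ori\<inverse>" by unfold_locales (fact, rule rev)
  let ?w = "descending_welfare P \<sigma>1 \<sigma>2 sel"
  \<comment> \<open>One greedy bound with factor 2 for each orientation; their sum bounds every
    matching, however its edges are oriented.\<close>
  define G where "G v = 2 * O.greedy_weight v + 2 * O'.greedy_weight v" for v
  have G: "integrable W G" "(\<integral>v. G v \<partial>W) = 2 * ?w Ori + 2 * ?w (Ori\<inverse>)"
    unfolding G_def O.descending_welfare_eq O'.descending_welfare_eq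
    using O.greedy_weight_integrable O'.greedy_weight_integrable by simp_all
  have G0: "0 \<le> (\<integral>v. G v \<partial>W)"
    using O.greedy_weight_nonneg O'.greedy_weight_nonneg
    by (intro integral_nonneg_AE AE_I2) (simp add: G_def)
  have bound: "(\<Sum>b \<in> Box. of_bool (edge b \<in> M \<and> Q b) * k1 b v) \<le> G v"
    if "v \<in> space W" "is_matching P M" for v M Q
  proof -
    have "Box = Ori \<union> Ori\<inverse>"
      using O.Ori_boxes O'.Ori_boxes O.swap_in_Ori by force
    moreover have "Ori \<inter> Ori\<inverse> = {}"
      using O.swap_notin_Ori by force
    ultimately have "(\<Sum>b \<in> Box. of_bool (edge b \<in> M \<and> Q b) * k1 b v)
        = (\<Sum>b \<in> Ori. of_bool (edge b \<in> M \<and> Q b) * k1 b v)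
        + (\<Sum>b \<in> Ori\<inverse>. of_bool (edge b \<in> M \<and> Q b) * k1 b v)"
      using O.finite_Ori O'.finite_Ori by (simp only: sum.union_disjoint)
    also have "\<dots> \<le> G v"
      unfolding G_def by (intro add_mono O.matching_weight_le O'.matching_weight_le that)
    finally show ?thesis .
  qed
  have best: "best_of_two_worlds_welfare P \<sigma>1 \<sigma>2 sel Ori = max (?w Ori) (?w (Ori\<inverse>))"
    by (simp add: best_of_two_worlds_welfare_def run_best_of_two_worlds_def descending_welfare_def max_def)
  have alg: "welfare P R \<pi> \<le> (\<integral>v. G v \<partial>W)" if \<pi>: "is_algorithm P R \<pi>" for \<pi>
  proof -
    let ?f = "\<lambda>(s, v). payoff P v (run_algorithm (\<pi> s) v)"
    \<comment> \<open>The bound on the welfare does not depend on the seed, so averaging over seeds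
      preserves it.\<close>
    have seed: "(\<integral>v. ?f (s, v) \<partial>W) \<le> (\<integral>v. G v \<partial>W)" if s: "s \<in> space R" for s
    proof -
      interpret policy P \<sigma>1 \<sigma>2 "\<pi> s"
      proof unfold_locales
        fix bs :: "('v \<times> 'v) list" assume bs: "distinct bs" "set bs \<subseteq> Box"
        show "legal_action P bs (\<pi> s (observe v bs))" if "v \<in> space W" for v
          using \<pi> s bs that unfolding is_algorithm_def value_measure_eq by blast
        have "(\<lambda>(s, v). \<pi> s (observe v bs)) \<in> R \<Otimes>\<^sub>M W \<rightarrow>\<^sub>M count_space UNIV"
          using \<pi> bs unfolding is_algorithm_def value_measure_eq by blast
        from measurable_compose[OF measurable_Pair1'[OF s] this]
        show "(\<lambda>v. \<pi> s (observe v bs)) \<in> W \<rightarrow>\<^sub>M count_space UNIV" by simp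
      qed
      show ?thesis
        using welfare_le[OF G(1) G0 bound] by simp
    qed
    interpret RW: pair_prob_space R W ..
    \<comment> \<open>The integral of a non-integrable function is 0, so that case is harmless.\<close>
    show ?thesis
    proof (cases "integrable (R \<Otimes>\<^sub>M W) ?f")
      case True
      have "welfare P R \<pi> = (\<integral>s. (\<integral>v. ?f (s, v) \<partial>W) \<partial>R)"
        unfolding welfare_def value_measure_eq by (rule RW.integral_fst'[OF True, symmetric])
      also have "\<dots> \<le> (\<integral>s. (\<integral>v. G v \<partial>W) \<partial>R)"
        by (rule integral_mono[OF RW.integrable_fst'[OF True]]) (use seed in auto)
      finally show ?thesis by (simp add: R.prob_space)
    next
      case False
      then show ?thesis
        using G0 unfolding welfare_def value_measure_eq by (simp add: not_integrable_integral_eq)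
    qed
  qed
  have "opt_welfare P R \<le> ereal (\<integral>v. G v \<partial>W)"
    unfolding opt_welfare_def using alg by (intro SUP_least) auto
  then have "ereal (1 / 4) * opt_welfare P R \<le> ereal (1 / 4) * ereal (\<integral>v. G v \<partial>W)"
    by (rule ereal_mult_left_mono) simp
  \<comment> \<open>The mean of \<open>G\<close> is twice the sum of the two welfares, hence at most
    four times the larger one.\<close>
  also have "\<dots> \<le> ereal (best_of_two_worlds_welfare P \<sigma>1 \<sigma>2 sel Ori)"
    unfolding best G(2) by (simp add: max_def)
  finally show ?thesis .
qed

end
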